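(* Let $n\geq1$, let $\mu$ be Lebesgue measure on $\mathbb{R}^n$, let $\omega_{n+1}=\frac{2\pi^{(n+1)/2}}{\Gamma((n+1)/2)}$ and let $\nu$ be the probability measure on $\mathbb{R}^n$ with density $y\mapsto\frac{2}{\omega_{n+1}(1+|y|^2)^{\frac{n+1}{2}}}$ with respect to $\mu$. Let $(\mathrm{P}_{t})_{t\geq0}$ be the Poisson semigroup on $L^\infty(\mathbb{R}^n)$. Put $N=L^\infty(\mathbb{R}^n)\overline{\otimes}L^\infty(\mathbb{R}^n,\nu)=L^\infty(\mathbb{R}^n\times\mathbb{R}^n,\mu\otimes\nu)$, and define - $J\colon L^\infty(\mathbb{R}^n)\to N$, $J(f)=f\otimes1$; - $\mathbb{E}\colon N\to L^\infty(\mathbb{R}^n)$, the trace preserving normal faithful conditional expectation $f\otimes g\mapsto\left(\int_{\mathbb{R}^n}g\,d\nu\right)f$ associated with $J$; - $U_t\colon N\to N$, $[U_t(g)](x,y)=g(x-ty,y)$, for $t\in\mathbb{R}$. Then $J$ is a trace preserving unital normal $*$-monomorphism, $(U_t)_{t\in\mathbb{R}}$ is a weak* continuous group of trace preserving $*$-automorphisms of $N$, and $$\mathrm{P}_{t}=\mathbb{E}U_tJ,\qquad t\geq0.$$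
   Context: The Poisson semigroup on $L^\infty(\mathbb{R}^n)$ is given by $\mathrm{P}_0=\mathrm{Id}$ and, for $t>0$, $f\in L^\infty(\mathbb{R}^n)$ and almost all $x\in\mathbb{R}^n$, $[\mathrm{P}_t(f)](x)=\int_{\mathbb{R}^n}\frac{2t}{\omega_{n+1}(t^2+|y|^2)^{\frac{n+1}{2}}}f(x-y)\,d\mu(y)$, where $|\cdot|$ is the Euclidean norm. The traces on $L^\infty(\mathbb{R}^n)$ and $N$ are the integrals with respect to $\mu$ and $\mu\otimes\nu$. Weak* continuity of the group means that $t\mapsto\langle h,U_t(g)\rangle_{N_*,N}$ is continuous for all $g\in N$, $h\in N_*$. *)

theory Defs
  imports "HOL-Probability.Probability"
begin

(* Elements of L^infinity(M) are honest equivalence classes (sets of functions) modulo M-almost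
   everywhere equality. A map given on representatives is transported to classes with the_elem
   (as for quotients in HOL-Algebra): its value is determined only if it does not depend on the
   representative, so well-definedness is never built in and has to be proved. *)

type_synonym 'a linf = "('a \<Rightarrow> complex) set"

definition ess_bounded :: "'a measure \<Rightarrow> ('a \<Rightarrow> complex) set" where
  "ess_bounded M = {f \<in> borel_measurable M. \<exists>C::real. AE x in M. norm (f x) \<le> C}"

definition ae_class :: "'a measure \<Rightarrow> ('a \<Rightarrow> complex) \<Rightarrow> 'a linf" where
  "ae_class M f = {g \<in> ess_bounded M. AE x in M. g x = f x}"

definition Linf :: "'a measure \<Rightarrow> 'a linf set" where
  "Linf M = ae_class M ` ess_bounded M"

definition on_class :: "(('a \<Rightarrow> complex) \<Rightarrow> 'b) \<Rightarrow> 'a linf \<Rightarrow> 'b" where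
  "on_class F a = the_elem (F ` a)"

definition on_class2 ::
  "(('a \<Rightarrow> complex) \<Rightarrow> ('b \<Rightarrow> complex) \<Rightarrow> 'c) \<Rightarrow> 'a linf \<Rightarrow> 'b linf \<Rightarrow> 'c" where
  "on_class2 F a b = the_elem {F f g | f g. f \<in> a \<and> g \<in> b}"

definition linf_zero :: "'a measure \<Rightarrow> 'a linf" where
  "linf_zero M = ae_class M (\<lambda>x. 0)"

definition linf_one :: "'a measure \<Rightarrow> 'a linf" where
  "linf_one M = ae_class M (\<lambda>x. 1)"

definition linf_add :: "'a measure \<Rightarrow> 'a linf \<Rightarrow> 'a linf \<Rightarrow> 'a linf" where
  "linf_add M = on_class2 (\<lambda>f g. ae_class M (\<lambda>x. f x + g x))"

definition linf_mult :: "'a measure \<Rightarrow> 'a linf \<Rightarrow> 'a linf \<Rightarrow> 'a linf" where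
  "linf_mult M = on_class2 (\<lambda>f g. ae_class M (\<lambda>x. f x * g x))"

definition linf_scale :: "'a measure \<Rightarrow> complex \<Rightarrow> 'a linf \<Rightarrow> 'a linf" where
  "linf_scale M c = on_class (\<lambda>f. ae_class M (\<lambda>x. c * f x))"

definition linf_star :: "'a measure \<Rightarrow> 'a linf \<Rightarrow> 'a linf" where
  "linf_star M = on_class (\<lambda>f. ae_class M (\<lambda>x. cnj (f x)))"

definition linf_tensor :: "'a measure \<Rightarrow> 'b measure \<Rightarrow> 'a linf \<Rightarrow> 'b linf \<Rightarrow> ('a \<times> 'b) linf" where
  "linf_tensor M M' = on_class2 (\<lambda>f g. ae_class (M \<Otimes>\<^sub>M M') (\<lambda>(x, y). f x * g y))"

definition Linf_pos :: "'a measure \<Rightarrow> 'a linf set" where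
  "Linf_pos M = {a \<in> Linf M. \<exists>f\<in>a. AE x in M. f x \<in> \<real>\<^sub>\<ge>\<^sub>0}"

(* The trace is the [0,infinity]-valued weight on the positive cone; it is only used there. *)
definition linf_trace :: "'a measure \<Rightarrow> 'a linf \<Rightarrow> ennreal" where
  "linf_trace M = on_class (\<lambda>f. \<integral>\<^sup>+x. ennreal (Re (f x)) \<partial>M)"

definition linf_integral :: "'a measure \<Rightarrow> 'a linf \<Rightarrow> complex" where
  "linf_integral M = on_class (\<lambda>f. \<integral>x. f x \<partial>M)"

(* Duality between the predual L^1(M) and L^infinity(M), for integrable h. *)
definition linf_pairing :: "'a measure \<Rightarrow> ('a \<Rightarrow> complex) \<Rightarrow> 'a linf \<Rightarrow> complex" where
  "linf_pairing M h = on_class (\<lambda>f. \<integral>x. h x * f x \<partial>M)"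

definition weak_star_topology :: "'a measure \<Rightarrow> 'a linf topology" where
  "weak_star_topology M = topology_generated_by
     {{a \<in> Linf M. linf_pairing M h a \<in> S} | h S. integrable M h \<and> open S}"

definition normal_map :: "'a measure \<Rightarrow> 'b measure \<Rightarrow> ('a linf \<Rightarrow> 'b linf) \<Rightarrow> bool" where
  "normal_map M N T \<longleftrightarrow> continuous_map (weak_star_topology M) (weak_star_topology N) T"

definition trace_preserving :: "'a measure \<Rightarrow> 'b measure \<Rightarrow> ('a linf \<Rightarrow> 'b linf) \<Rightarrow> bool" where
  "trace_preserving M N T \<longleftrightarrow> (\<forall>a\<in>Linf_pos M. linf_trace N (T a) = linf_trace M a)"

definition linf_linear :: "'a measure \<Rightarrow> 'b measure \<Rightarrow> ('a linf \<Rightarrow> 'b linf) \<Rightarrow> bool" where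
  "linf_linear M N T \<longleftrightarrow>
     (\<forall>a\<in>Linf M. T a \<in> Linf N) \<and>
     (\<forall>a\<in>Linf M. \<forall>b\<in>Linf M. T (linf_add M a b) = linf_add N (T a) (T b)) \<and>
     (\<forall>c. \<forall>a\<in>Linf M. T (linf_scale M c a) = linf_scale N c (T a))"

definition star_homomorphism :: "'a measure \<Rightarrow> 'b measure \<Rightarrow> ('a linf \<Rightarrow> 'b linf) \<Rightarrow> bool" where
  "star_homomorphism M N T \<longleftrightarrow>
     linf_linear M N T \<and>
     (\<forall>a\<in>Linf M. \<forall>b\<in>Linf M. T (linf_mult M a b) = linf_mult N (T a) (T b)) \<and>
     (\<forall>a\<in>Linf M. T (linf_star M a) = linf_star N (T a))"

definition star_monomorphism :: "'a measure \<Rightarrow> 'b measure \<Rightarrow> ('a linf \<Rightarrow> 'b linf) \<Rightarrow> bool" where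
  "star_monomorphism M N T \<longleftrightarrow> star_homomorphism M N T \<and> inj_on T (Linf M)"

definition star_automorphism :: "'a measure \<Rightarrow> ('a linf \<Rightarrow> 'a linf) \<Rightarrow> bool" where
  "star_automorphism M T \<longleftrightarrow> star_homomorphism M M T \<and> bij_betw T (Linf M) (Linf M)"

definition unital_map :: "'a measure \<Rightarrow> 'b measure \<Rightarrow> ('a linf \<Rightarrow> 'b linf) \<Rightarrow> bool" where
  "unital_map M N T \<longleftrightarrow> T (linf_one M) = linf_one N"

(* J o E is a conditional expectation of L^infinity(N) onto the subalgebra J(L^infinity(M)): a
   positive linear projection that is a bimodule map over that subalgebra. *)
definition conditional_expectation ::
  "'a measure \<Rightarrow> 'b measure \<Rightarrow> ('a linf \<Rightarrow> 'b linf) \<Rightarrow> ('b linf \<Rightarrow> 'a linf) \<Rightarrow> bool" where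
  "conditional_expectation M N J E \<longleftrightarrow>
     linf_linear N M E \<and>
     (\<forall>x\<in>Linf_pos N. E x \<in> Linf_pos M) \<and>
     (\<forall>a\<in>Linf M. E (J a) = a) \<and>
     (\<forall>a\<in>Linf M. \<forall>b\<in>Linf M. \<forall>x\<in>Linf N.
        E (linf_mult N (linf_mult N (J a) x) (J b)) = linf_mult M (linf_mult M a (E x)) b)"

definition faithful_map :: "'a measure \<Rightarrow> 'b measure \<Rightarrow> ('a linf \<Rightarrow> 'b linf) \<Rightarrow> bool" where
  "faithful_map M N T \<longleftrightarrow> (\<forall>a\<in>Linf_pos M. T a = linf_zero N \<longrightarrow> a = linf_zero M)"

definition tp_normal_faithful_cond_exp ::
  "'a measure \<Rightarrow> 'b measure \<Rightarrow> ('a linf \<Rightarrow> 'b linf) \<Rightarrow> ('b linf \<Rightarrow> 'a linf) \<Rightarrow> bool" where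
  "tp_normal_faithful_cond_exp M N J E \<longleftrightarrow>
     conditional_expectation M N J E \<and>
     trace_preserving N M E \<and> normal_map N M E \<and> faithful_map N M E"

definition weak_star_continuous_group :: "'a measure \<Rightarrow> (real \<Rightarrow> 'a linf \<Rightarrow> 'a linf) \<Rightarrow> bool" where
  "weak_star_continuous_group M U \<longleftrightarrow>
     (\<forall>a\<in>Linf M. U 0 a = a) \<and>
     (\<forall>s t. \<forall>a\<in>Linf M. U (s + t) a = U s (U t a)) \<and>
     (\<forall>a\<in>Linf M. \<forall>h. integrable M h \<longrightarrow>
        continuous_on UNIV (\<lambda>t. linf_pairing M h (U t a)))"

(* omega_m, the surface area of the unit sphere of R^m *)
definition sphere_area :: "nat \<Rightarrow> real" where
  "sphere_area m = 2 * pi powr (real m / 2) / Gamma (real m / 2)"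

definition poisson_kernel :: "real \<Rightarrow> real ^ 'n \<Rightarrow> real" where
  "poisson_kernel t y =
     2 * t / (sphere_area (CARD('n) + 1) * (t\<^sup>2 + (norm y)\<^sup>2) powr (real (CARD('n) + 1) / 2))"

definition poisson_semigroup :: "real \<Rightarrow> (real ^ 'n) linf \<Rightarrow> (real ^ 'n) linf" where
  "poisson_semigroup t a =
     (if t = 0 then a
      else on_class (\<lambda>f. ae_class lborel
             (\<lambda>x. \<integral>y. complex_of_real (poisson_kernel t y) * f (x - y) \<partial>lborel)) a)"

definition shear ::
  "('a \<times> 'a) measure \<Rightarrow> real \<Rightarrow> ('a::real_vector \<times> 'a) linf \<Rightarrow> ('a \<times> 'a) linf" where
  "shear N t = on_class (\<lambda>g. ae_class N (\<lambda>(x, y). g (x - t *\<^sub>R y, y)))"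

end

theory Submission imports Defs begin

text \<open>The Poisson kernel at time \<open>t\<close> is the image of \<open>\<nu>\<close> under \<open>y \<mapsto> t y\<close>, so \<open>P\<^sub>t f (x)\<close> is the \<open>\<nu>\<close>-mean
  of \<open>f (x - t y)\<close> over \<open>y\<close> (\<open>integral_poisson_kernel_dilation\<close>). The three steps of this description
  are the maps of the theorem: \<open>J\<close> regards \<open>f\<close> as a function of \<open>(x, y)\<close>, \<open>U\<^sub>t\<close> moves \<open>x\<close> with
  velocity \<open>-y\<close>, and the conditional expectation averages over \<open>y\<close>.

  Both \<open>J\<close> and \<open>U\<^sub>t\<close> are composition with a measure preserving map, namely with the projection to
  \<open>x\<close> and with the shear \<open>(x, y) \<mapsto> (x - t y, y)\<close>. Such a composition operator is always a
  trace preserving unital \<open>*\<close>-monomorphism (locale \<open>koopman\<close>). That \<open>\<nu>\<close> is a probability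
  measure comes from writing its density as a mixture of Gaussians
  (\<open>nn_integral_poisson_profile\<close>).

  The conditional expectation exists as the average over the fibres of the projection
  (\<open>fibre_mean_cond_exp\<close>). It is unique because the bimodule property and trace preservation
  prescribe the integrals of \<open>E(x)\<close> over all measurable sets when \<open>x\<close> is positive, and positive
  elements span (\<open>conditional_expectation_unique\<close>). Hence every identity about an arbitrary such
  \<open>E\<close> may be checked on the fibre average.

  Weak* continuity of the group is the continuity of \<open>t \<mapsto> \<langle>h, U\<^sub>t g\<rangle>\<close>. As the shears
  preserve the measure they can be moved to \<open>h \<in> L\<^sup>1\<close>, and the functions \<open>h\<close> with the required
  continuity form a class that is closed under dominated limits and contains the continuous
  functions with bounded support (\<open>integrable_induct_continuous\<close>, \<open>continuous_shear_predual\<close>).\<close>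

section \<open>Calculus in $L^\infty$\<close>

text \<open>As an eager elimination rule, \<open>AE_mp\<close> sends the classical reasoner into a loop on
  almost everywhere bounds.\<close>

declare AE_mp [rule del]

lemma ess_boundedI:
  "f \<in> borel_measurable M \<Longrightarrow> AE x in M. norm (f x) \<le> C \<Longrightarrow> f \<in> ess_bounded M"
  by (auto simp: ess_bounded_def)

lemma ess_bounded_measurable[measurable_dest]: "f \<in> ess_bounded M \<Longrightarrow> f \<in> borel_measurable M"
  by (simp add: ess_bounded_def)

lemma ess_boundedE:
  assumes "f \<in> ess_bounded M"
  obtains C where "C \<ge> 0" "f \<in> borel_measurable M" "AE x in M. norm (f x) \<le> C"
proof -
  from assms obtain C where C: "AE x in M. norm (f x) \<le> C" and f: "f \<in> borel_measurable M"
    by (auto simp: ess_bounded_def)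
  have "AE x in M. norm (f x) \<le> max C 0" using C by eventually_elim simp
  with f show ?thesis by (intro that[of "max C 0"]) auto
qed

lemma ess_bounded_const[simp, intro]: "(\<lambda>x. c) \<in> ess_bounded M"
  by (rule ess_boundedI[where C = "norm c"]) auto

lemma ess_bounded_add[intro]:
  assumes "f \<in> ess_bounded M" "g \<in> ess_bounded M"
  shows "(\<lambda>x. f x + g x) \<in> ess_bounded M"
proof -
  from assms(1) obtain C where [measurable]: "f \<in> borel_measurable M"
    and C: "AE x in M. norm (f x) \<le> C" by (rule ess_boundedE)
  from assms(2) obtain D where [measurable]: "g \<in> borel_measurable M"
    and D: "AE x in M. norm (g x) \<le> D" by (rule ess_boundedE)
  show ?thesis
  proof (rule ess_boundedI)
    show "AE x in M. norm (f x + g x) \<le> C + D"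
      using C D by eventually_elim (meson add_mono norm_triangle_le)
  qed simp
qed

lemma ess_bounded_mult[intro]:
  assumes "f \<in> ess_bounded M" "g \<in> ess_bounded M"
  shows "(\<lambda>x. f x * g x) \<in> ess_bounded M"
proof -
  from assms(2) obtain D where [measurable]: "g \<in> borel_measurable M"
    and D: "AE x in M. norm (g x) \<le> D" by (rule ess_boundedE)
  from assms(1) obtain C where [measurable]: "f \<in> borel_measurable M" and "C \<ge> 0"
    and C: "AE x in M. norm (f x) \<le> C" by (rule ess_boundedE)
  show ?thesis
  proof (rule ess_boundedI)
    show "AE x in M. norm (f x * g x) \<le> C * D"
      using C D by eventually_elim (use \<open>C \<ge> 0\<close> in \<open>auto simp: norm_mult intro: mult_mono\<close>)
  qed simp
qed

lemma ess_bounded_cnj[intro]: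
  assumes "f \<in> ess_bounded M"
  shows "(\<lambda>x. cnj (f x)) \<in> ess_bounded M"
proof -
  have [measurable]: "cnj \<in> borel_measurable borel"
    by (intro borel_measurable_continuous_onI continuous_intros)
  from assms have [measurable]: "f \<in> borel_measurable M" by (rule ess_bounded_measurable)
  from assms show ?thesis by (auto simp: ess_bounded_def)
qed

lemma integrable_mult_ess_bounded:
  assumes h: "integrable M h" and f: "f \<in> ess_bounded M"
  shows "integrable M (\<lambda>x. h x * f x)"
proof -
  from f obtain C where "C \<ge> 0" and [measurable]: "f \<in> borel_measurable M"
    and C: "AE x in M. norm (f x) \<le> C" by (rule ess_boundedE)
  note [measurable] = borel_measurable_integrable[OF h]
  show ?thesis
  proof (rule Bochner_Integration.integrable_bound)
    show "integrable M (\<lambda>x. C *\<^sub>R h x)" using h by simp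
    show "AE x in M. norm (h x * f x) \<le> norm (C *\<^sub>R h x)"
      using C
    proof eventually_elim
      case (elim x)
      have "norm (h x) * norm (f x) \<le> norm (h x) * C"
        by (rule mult_left_mono[OF elim]) simp
      then show ?case using \<open>C \<ge> 0\<close> by (simp add: norm_mult mult.commute)
    qed
  qed simp
qed

lemma mem_ae_class_self: "f \<in> ess_bounded M \<Longrightarrow> f \<in> ae_class M f"
  by (simp add: ae_class_def)

lemma ae_class_cong: "AE x in M. f x = g x \<Longrightarrow> ae_class M f = ae_class M g"
  unfolding ae_class_def by (intro Collect_cong conj_cong refl iffI) (erule (1) eventually_elim2, simp)+

lemma ae_class_eqD:
  "f \<in> ess_bounded M \<Longrightarrow> ae_class M f = ae_class M g \<Longrightarrow> AE x in M. f x = g x"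
proof -
  assume "f \<in> ess_bounded M" "ae_class M f = ae_class M g"
  then have "f \<in> ae_class M g" using mem_ae_class_self by metis
  then show ?thesis by (simp add: ae_class_def)
qed

lemma ae_class_in_Linf[intro]: "f \<in> ess_bounded M \<Longrightarrow> ae_class M f \<in> Linf M"
  by (simp add: Linf_def)

lemma LinfE:
  assumes "a \<in> Linf M"
  obtains f where "f \<in> ess_bounded M" "a = ae_class M f"
  using assms by (auto simp: Linf_def)

lemma on_class_ae_class:
  assumes f: "f \<in> ess_bounded M"
    and F: "\<And>g. g \<in> ess_bounded M \<Longrightarrow> AE x in M. g x = f x \<Longrightarrow> F g = F f"
  shows "on_class F (ae_class M f) = F f"
proof -
  have "F g = F f" if "g \<in> ae_class M f" for g
    using that F by (simp add: ae_class_def)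
  then have "F ` ae_class M f = {F f}"
    using mem_ae_class_self[OF f] by blast
  then show ?thesis by (simp add: on_class_def)
qed

lemma on_class2_ae_class:
  assumes f: "f \<in> ess_bounded M" and g: "g \<in> ess_bounded N"
    and F: "\<And>f' g'. f' \<in> ess_bounded M \<Longrightarrow> AE x in M. f' x = f x \<Longrightarrow>
                   g' \<in> ess_bounded N \<Longrightarrow> AE x in N. g' x = g x \<Longrightarrow> F f' g' = F f g"
  shows "on_class2 F (ae_class M f) (ae_class N g) = F f g"
proof -
  have "F f' g' = F f g" if "f' \<in> ae_class M f" "g' \<in> ae_class N g" for f' g'
    using that F by (simp add: ae_class_def)
  then have "{F f' g' | f' g'. f' \<in> ae_class M f \<and> g' \<in> ae_class N g} = {F f g}"
    using mem_ae_class_self[OF f] mem_ae_class_self[OF g] by blast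
  then show ?thesis by (simp add: on_class2_def)
qed

lemma linf_add_ae_class:
  "f \<in> ess_bounded M \<Longrightarrow> g \<in> ess_bounded M \<Longrightarrow>
   linf_add M (ae_class M f) (ae_class M g) = ae_class M (\<lambda>x. f x + g x)"
  unfolding linf_add_def by (rule on_class2_ae_class) (auto intro!: ae_class_cong elim: eventually_elim2)

lemma linf_mult_ae_class:
  "f \<in> ess_bounded M \<Longrightarrow> g \<in> ess_bounded M \<Longrightarrow>
   linf_mult M (ae_class M f) (ae_class M g) = ae_class M (\<lambda>x. f x * g x)"
  unfolding linf_mult_def by (rule on_class2_ae_class) (auto intro!: ae_class_cong elim: eventually_elim2)

lemma linf_scale_ae_class:
  "f \<in> ess_bounded M \<Longrightarrow> linf_scale M c (ae_class M f) = ae_class M (\<lambda>x. c * f x)"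
  unfolding linf_scale_def by (rule on_class_ae_class) (auto intro!: ae_class_cong)

lemma linf_star_ae_class:
  "f \<in> ess_bounded M \<Longrightarrow> linf_star M (ae_class M f) = ae_class M (\<lambda>x. cnj (f x))"
  unfolding linf_star_def by (rule on_class_ae_class) (auto intro!: ae_class_cong)

lemma linf_trace_ae_class:
  "f \<in> ess_bounded M \<Longrightarrow> linf_trace M (ae_class M f) = (\<integral>\<^sup>+x. ennreal (Re (f x)) \<partial>M)"
  unfolding linf_trace_def by (rule on_class_ae_class) (auto intro!: nn_integral_cong_AE elim: eventually_mono)

lemma linf_integral_ae_class:
  "f \<in> ess_bounded M \<Longrightarrow> linf_integral M (ae_class M f) = (\<integral>x. f x \<partial>M)"
  unfolding linf_integral_def
  by (rule on_class_ae_class) (auto intro!: integral_cong_AE ess_bounded_measurable)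

lemma linf_pairing_ae_class:
  assumes h: "integrable M h" and f: "f \<in> ess_bounded M"
  shows "linf_pairing M h (ae_class M f) = (\<integral>x. h x * f x \<partial>M)"
  unfolding linf_pairing_def
proof (rule on_class_ae_class[OF f])
  fix g assume g: "g \<in> ess_bounded M" "AE x in M. g x = f x"
  note [measurable] = borel_measurable_integrable[OF h] ess_bounded_measurable[OF f]
    ess_bounded_measurable[OF g(1)]
  show "(\<integral>x. h x * g x \<partial>M) = (\<integral>x. h x * f x \<partial>M)"
    by (rule integral_cong_AE) (use g(2) in \<open>auto elim: eventually_mono\<close>)
qed

lemma ae_class_Linf_pos:
  "f \<in> ess_bounded M \<Longrightarrow> AE x in M. f x \<in> \<real>\<^sub>\<ge>\<^sub>0 \<Longrightarrow> ae_class M f \<in> Linf_pos M"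
  using mem_ae_class_self[of f M] by (auto simp: Linf_pos_def)

lemma Linf_posE:
  assumes "a \<in> Linf_pos M"
  obtains f where "f \<in> ess_bounded M" "a = ae_class M f" "AE x in M. f x \<in> \<real>\<^sub>\<ge>\<^sub>0"
proof -
  from assms obtain g f where "g \<in> ess_bounded M" and a: "a = ae_class M g"
    and f: "f \<in> a" "AE x in M. f x \<in> \<real>\<^sub>\<ge>\<^sub>0"
    unfolding Linf_pos_def Linf_def by blast
  then have "f \<in> ess_bounded M" "AE x in M. f x = g x" by (simp_all add: ae_class_def)
  with a f(2) show ?thesis by (intro that[of f]) (simp_all add: ae_class_cong)
qed

lemma topspace_weak_star_topology: "topspace (weak_star_topology M) = Linf M"
proof -
  let ?B = "{{a \<in> Linf M. linf_pairing M h a \<in> S} | h S. integrable M h \<and> open S}"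
  have "Linf M = {a \<in> Linf M. linf_pairing M (\<lambda>x. 0) a \<in> UNIV}" by auto
  then have "Linf M \<in> ?B" by (intro CollectI exI[of _ "\<lambda>x. 0"] exI[of _ UNIV]) auto
  then show ?thesis unfolding weak_star_topology_def topology_generated_by_topspace by blast
qed

text \<open>A preadjoint \<open>h \<mapsto> h'\<close> pulls the subbasic open set given by \<open>h\<close> back to the one given by \<open>h'\<close>.\<close>

lemma normal_mapI:
  assumes K: "\<And>a. a \<in> Linf M \<Longrightarrow> K a \<in> Linf N"
    and preadjoint: "\<And>h. integrable N h \<Longrightarrow>
      \<exists>h'. integrable M h' \<and> (\<forall>a\<in>Linf M. linf_pairing N h (K a) = linf_pairing M h' a)"
  shows "normal_map M N K"
proof -
  let ?B = "\<lambda>M. {{a \<in> Linf M. linf_pairing M h a \<in> S} | h S. integrable M h \<and> open S}"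
  note top = topspace_weak_star_topology
  have "continuous_map (weak_star_topology M) (topology_generated_by (?B N)) K"
  proof (rule continuous_on_generated_topo)
    fix V assume "V \<in> ?B N"
    then obtain h S where h: "integrable N h" "open S"
      and V: "V = {a \<in> Linf N. linf_pairing N h a \<in> S}" by auto
    from preadjoint[OF h(1)] obtain h' where h': "integrable M h'"
      "\<And>a. a \<in> Linf M \<Longrightarrow> linf_pairing N h (K a) = linf_pairing M h' a" by auto
    have "K -` V \<inter> Linf M = {a \<in> Linf M. linf_pairing M h' a \<in> S}"
      using K h'(2) by (auto simp: V)
    then show "openin (weak_star_topology M) (K -` V \<inter> topspace (weak_star_topology M))"
      unfolding top unfolding weak_star_topology_def
      by (intro topology_generated_by_Basis) (use h'(1) h(2) in auto)
  next
    have "topspace (weak_star_topology N) = \<Union> (?B N)"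
      by (simp add: weak_star_topology_def)
    then show "K ` topspace (weak_star_topology M) \<subseteq> \<Union> (?B N)"
      unfolding top using K by (metis image_subsetI)
  qed
  then show ?thesis by (simp add: normal_map_def weak_star_topology_def)
qed

section \<open>Composition with a measure preserving map\<close>

text \<open>The equation for \<open>K\<close> concerns classes of essentially bounded functions only, so that the
  locale applies to maps such as \<open>a \<mapsto> a \<otimes> 1\<close> that are not given as a composition operator. All algebraic properties follow
  pointwise; injectivity and trace preservation use that \<open>M\<close> is the image measure under \<open>T\<close>.\<close>

locale koopman =
  fixes M :: "'a measure" and N :: "'b measure" and T :: "'b \<Rightarrow> 'a"
    and K :: "'a linf \<Rightarrow> 'b linf"
  assumes T[measurable]: "T \<in> N \<rightarrow>\<^sub>M M"
    and distr_T: "distr N M T = M"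
    and K: "\<And>f. f \<in> ess_bounded M \<Longrightarrow> K (ae_class M f) = ae_class N (\<lambda>z. f (T z))"
begin

lemma AE_T: "AE x in M. P x \<Longrightarrow> AE z in N. P (T z)"
  by (rule AE_distrD[OF T, unfolded distr_T])

lemma ess_bounded_T[intro]:
  assumes "f \<in> ess_bounded M"
  shows "(\<lambda>z. f (T z)) \<in> ess_bounded N"
proof -
  from assms obtain C where [measurable]: "f \<in> borel_measurable M"
    and C: "AE x in M. norm (f x) \<le> C" by (rule ess_boundedE)
  show ?thesis by (rule ess_boundedI[OF _ AE_T[OF C]]) simp
qed

lemma K_Linf: "a \<in> Linf M \<Longrightarrow> K a \<in> Linf N"
  by (auto elim!: LinfE simp: K ess_bounded_T ae_class_in_Linf)

lemma star_homomorphism: "star_homomorphism M N K"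
  unfolding star_homomorphism_def linf_linear_def
  by (auto elim!: LinfE
      simp: K linf_add_ae_class linf_mult_ae_class linf_scale_ae_class linf_star_ae_class
        ess_bounded_T ess_bounded_add ess_bounded_mult ess_bounded_cnj
      intro!: ae_class_in_Linf)

lemma inj: "inj_on K (Linf M)"
proof (rule inj_onI)
  fix a b assume "a \<in> Linf M" "b \<in> Linf M" and eq: "K a = K b"
  then obtain f g where f: "f \<in> ess_bounded M" "a = ae_class M f"
    and g: "g \<in> ess_bounded M" "b = ae_class M g" by (metis LinfE)
  note [measurable] = ess_bounded_measurable[OF f(1)] ess_bounded_measurable[OF g(1)]
  have "AE z in N. f (T z) = g (T z)"
    using eq by (intro ae_class_eqD ess_bounded_T) (simp_all add: f g K)
  then have "AE x in distr N M T. f x = g x"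
    by (subst AE_distr_iff) simp_all
  then show "a = b" unfolding distr_T f g by (rule ae_class_cong)
qed

lemma star_monomorphism: "star_monomorphism M N K"
  by (simp add: star_monomorphism_def star_homomorphism inj)

lemma unital: "unital_map M N K"
  by (simp add: unital_map_def linf_one_def K)

lemma trace_preserving: "trace_preserving M N K"
  unfolding trace_preserving_def
proof
  fix a assume "a \<in> Linf_pos M"
  then obtain f where f: "f \<in> ess_bounded M" "a = ae_class M f" by (rule Linf_posE)
  note [measurable] = ess_bounded_measurable[OF f(1)]
  have "(\<integral>\<^sup>+z. ennreal (Re (f (T z))) \<partial>N) = (\<integral>\<^sup>+x. ennreal (Re (f x)) \<partial>distr N M T)"
    by (subst nn_integral_distr) simp_all
  then show "linf_trace N (K a) = linf_trace M a"
    using f by (simp add: K linf_trace_ae_class ess_bounded_T distr_T)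
qed

end

section \<open>Uniqueness of the conditional expectation\<close>

lemma linf_one_Linf_pos: "linf_one M \<in> Linf_pos M"
  unfolding linf_one_def by (rule ae_class_Linf_pos) auto

lemma Linf_pos_subset: "a \<in> Linf_pos M \<Longrightarrow> a \<in> Linf M"
  by (simp add: Linf_pos_def)

text \<open>With \<open>\<bar>f\<bar> \<le> C\<close>, both \<open>Re f + C\<close> and \<open>Im f + C\<close> are nonnegative, and
  \<open>f = (Re f + C) + \<i> (Im f + C) - (1 + \<i>) C\<close>.\<close>

lemma Linf_pos_span:
  assumes "x \<in> Linf M"
  obtains p q c where "p \<in> Linf_pos M" "q \<in> Linf_pos M"
    "x = linf_add M (linf_add M p (linf_scale M \<i> q)) (linf_scale M c (linf_one M))"
proof -
  from assms obtain f where f: "f \<in> ess_bounded M" and x: "x = ae_class M f" by (rule LinfE)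
  from f obtain C where "C \<ge> 0" and [measurable]: "f \<in> borel_measurable M"
    and C: "AE x in M. norm (f x) \<le> C" by (rule ess_boundedE)
  define p where "p = (\<lambda>x. complex_of_real (Re (f x) + C))"
  define q where "q = (\<lambda>x. complex_of_real (Im (f x) + C))"
  have norm_p: "norm (p x) \<le> norm (f x) + C" and norm_q: "norm (q x) \<le> norm (f x) + C" for x
    using abs_Re_le_cmod[of "f x"] abs_Im_le_cmod[of "f x"] \<open>C \<ge> 0\<close>
    unfolding p_def q_def norm_of_real by linarith+
  have p: "p \<in> ess_bounded M"
  proof (rule ess_boundedI)
    show "AE x in M. norm (p x) \<le> C + C"
      using C by eventually_elim (rule order_trans[OF norm_p], simp)
  qed (simp add: p_def)
  have q: "q \<in> ess_bounded M"
  proof (rule ess_boundedI)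
    show "AE x in M. norm (q x) \<le> C + C"
      using C by eventually_elim (rule order_trans[OF norm_q], simp)
  qed (simp add: q_def)
  have pos: "ae_class M p \<in> Linf_pos M" "ae_class M q \<in> Linf_pos M"
  proof -
    have "AE x in M. p x \<in> \<real>\<^sub>\<ge>\<^sub>0"
      using C
    proof eventually_elim
      case (elim x)
      with abs_Re_le_cmod[of "f x"] show ?case
        unfolding p_def nonneg_Reals_of_real_iff by linarith
    qed
    with p show "ae_class M p \<in> Linf_pos M" by (rule ae_class_Linf_pos)
    have "AE x in M. q x \<in> \<real>\<^sub>\<ge>\<^sub>0"
      using C
    proof eventually_elim
      case (elim x)
      with abs_Im_le_cmod[of "f x"] show ?case
        unfolding q_def nonneg_Reals_of_real_iff by linarith
    qed
    with q show "ae_class M q \<in> Linf_pos M" by (rule ae_class_Linf_pos)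
  qed
  have "f = (\<lambda>x. p x + \<i> * q x + (- (1 + \<i>) * C) * 1)"
    by (auto simp: fun_eq_iff p_def q_def complex_eq_iff)
  then have "x = linf_add M (linf_add M (ae_class M p) (linf_scale M \<i> (ae_class M q)))
      (linf_scale M (- (1 + \<i>) * C) (linf_one M))"
    using p q by (simp add: x linf_one_def linf_scale_ae_class linf_add_ae_class
        ess_bounded_add ess_bounded_mult)
  with pos show ?thesis by (rule that)
qed

lemma linf_scale_Linf: "a \<in> Linf M \<Longrightarrow> linf_scale M c a \<in> Linf M"
  by (auto elim!: LinfE simp: linf_scale_ae_class intro!: ae_class_in_Linf ess_bounded_mult)

lemma linf_add_Linf: "a \<in> Linf M \<Longrightarrow> b \<in> Linf M \<Longrightarrow> linf_add M a b \<in> Linf M"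
  by (auto elim!: LinfE simp: linf_add_ae_class intro!: ae_class_in_Linf ess_bounded_add)

lemma linf_mult_Linf: "a \<in> Linf M \<Longrightarrow> b \<in> Linf M \<Longrightarrow> linf_mult M a b \<in> Linf M"
  by (auto elim!: LinfE simp: linf_mult_ae_class intro!: ae_class_in_Linf ess_bounded_mult)

lemma linf_linear_eqI:
  assumes S: "linf_linear M N S" and T: "linf_linear M N T"
    and eq: "\<And>a. a \<in> Linf_pos M \<Longrightarrow> S a = T a" and x: "x \<in> Linf M"
  shows "S x = T x"
proof -
  from x obtain p q c where p: "p \<in> Linf_pos M" and q: "q \<in> Linf_pos M"
    and x_eq: "x = linf_add M (linf_add M p (linf_scale M \<i> q)) (linf_scale M c (linf_one M))"
    by (rule Linf_pos_span)
  have expand: "R x = linf_add N (linf_add N (R p) (linf_scale N \<i> (R q)))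
      (linf_scale N c (R (linf_one M)))" if "linf_linear M N R" for R
    using that p q linf_one_Linf_pos[of M] unfolding linf_linear_def x_eq
    by (simp add: Linf_pos_subset linf_scale_Linf linf_add_Linf)
  show ?thesis
    unfolding expand[OF S] expand[OF T] eq[OF p] eq[OF q] eq[OF linf_one_Linf_pos] ..
qed

text \<open>The traces \<open>tr (1\<^sub>A x)\<close>, with \<open>A\<close> ranging over the measurable sets, determine a positive
  element \<open>x\<close>: they are the values of the measure with density \<open>x\<close>.\<close>

lemma Linf_pos_eqI_trace:
  assumes "sigma_finite_measure M" and a: "a \<in> Linf_pos M" and b: "b \<in> Linf_pos M"
    and tr: "\<And>A. A \<in> sets M \<Longrightarrow>
      linf_trace M (linf_mult M (linf_mult M (ae_class M (indicator A)) a) (linf_one M)) =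
      linf_trace M (linf_mult M (linf_mult M (ae_class M (indicator A)) b) (linf_one M))"
  shows "a = b"
proof -
  interpret sigma_finite_measure M by fact
  from a obtain f where f: "f \<in> ess_bounded M" "a = ae_class M f" "AE x in M. f x \<in> \<real>\<^sub>\<ge>\<^sub>0"
    by (rule Linf_posE)
  from b obtain g where g: "g \<in> ess_bounded M" "b = ae_class M g" "AE x in M. g x \<in> \<real>\<^sub>\<ge>\<^sub>0"
    by (rule Linf_posE)
  note [measurable] = ess_bounded_measurable[OF f(1)] ess_bounded_measurable[OF g(1)]
  have val: "linf_trace M (linf_mult M (linf_mult M (ae_class M (indicator A)) (ae_class M u))
      (linf_one M)) = (\<integral>\<^sup>+x. ennreal (Re (u x)) * indicator A x \<partial>M)"
    if "A \<in> sets M" and u: "u \<in> ess_bounded M" for A u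
  proof -
    have [simp]: "(indicator A :: _ \<Rightarrow> complex) \<in> ess_bounded M"
      by (rule ess_boundedI[where C = 1]) (use that in \<open>auto simp: indicator_def\<close>)
    show ?thesis
      using u
      by (simp add: linf_one_def linf_mult_ae_class ess_bounded_mult linf_trace_ae_class)
        (auto simp: indicator_def intro!: nn_integral_cong)
  qed
  have "density M (\<lambda>x. ennreal (Re (f x))) = density M (\<lambda>x. ennreal (Re (g x)))"
  proof (rule measure_eqI)
    fix A assume "A \<in> sets (density M (\<lambda>x. ennreal (Re (f x))))"
    then have A: "A \<in> sets M" by simp
    show "emeasure (density M (\<lambda>x. ennreal (Re (f x)))) A =
        emeasure (density M (\<lambda>x. ennreal (Re (g x)))) A"
      using tr[OF A] A unfolding f(2) g(2) val[OF A f(1)] val[OF A g(1)]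
      by (simp add: emeasure_density)
  qed simp
  then have "AE x in M. ennreal (Re (f x)) = ennreal (Re (g x))"
    by (intro density_unique) simp_all
  then have "AE x in M. f x = g x"
    using f(3) g(3) by eventually_elim (auto simp: complex_nonneg_Reals_iff complex_eq_iff)
  then show "a = b" unfolding f(2) g(2) by (rule ae_class_cong)
qed

text \<open>The bimodule property and trace preservation give
  \<open>tr (1\<^sub>A E(x)) = tr (E (K(1\<^sub>A) x)) = tr (K(1\<^sub>A) x)\<close>, where the right-hand side does not involve \<open>E\<close>.\<close>

lemma (in koopman) conditional_expectation_unique:
  assumes "sigma_finite_measure M"
    and E: "tp_normal_faithful_cond_exp M N K E" and E': "tp_normal_faithful_cond_exp M N K E'"
    and x: "x \<in> Linf N"
  shows "E x = E' x"
proof (rule linf_linear_eqI[of N M E E'])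
  show "linf_linear N M E" "linf_linear N M E'"
    using E E' by (simp_all add: tp_normal_faithful_cond_exp_def conditional_expectation_def)
  fix x assume x: "x \<in> Linf_pos N"
  then obtain f where f: "f \<in> ess_bounded N" "x = ae_class N f" "AE x in N. f x \<in> \<real>\<^sub>\<ge>\<^sub>0"
    by (rule Linf_posE)
  have tr: "linf_trace M (linf_mult M (linf_mult M (ae_class M (indicator A)) (E x)) (linf_one M)) =
      linf_trace N (linf_mult N (linf_mult N (K (ae_class M (indicator A))) x) (K (linf_one M)))"
    if A: "A \<in> sets M" and E: "tp_normal_faithful_cond_exp M N K E" for A E
  proof -
    have ind: "(indicator A :: _ \<Rightarrow> complex) \<in> ess_bounded M"
      by (rule ess_boundedI[where C = 1]) (use A in \<open>auto simp: indicator_def\<close>)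
    have "linf_mult N (linf_mult N (K (ae_class M (indicator A))) x) (K (linf_one M)) =
        ae_class N (\<lambda>z. indicator A (T z) * f z * 1)"
      using ind f(1)
      by (simp add: linf_one_def K f(2) linf_mult_ae_class ess_bounded_mult ess_bounded_T)
    also have "\<dots> \<in> Linf_pos N"
    proof (rule ae_class_Linf_pos)
      show "(\<lambda>z. indicator A (T z) * f z * 1) \<in> ess_bounded N"
        by (intro ess_bounded_mult ess_bounded_T ind f(1) ess_bounded_const)
      show "AE z in N. indicator A (T z) * f z * 1 \<in> \<real>\<^sub>\<ge>\<^sub>0"
        using f(3) by eventually_elim (auto simp: indicator_def)
    qed
    finally have "linf_trace M (E (linf_mult N (linf_mult N (K (ae_class M (indicator A))) x)
          (K (linf_one M)))) =
        linf_trace N (linf_mult N (linf_mult N (K (ae_class M (indicator A))) x) (K (linf_one M)))"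
      using E by (simp add: tp_normal_faithful_cond_exp_def trace_preserving_def)
    moreover have "E (linf_mult N (linf_mult N (K (ae_class M (indicator A))) x) (K (linf_one M))) =
        linf_mult M (linf_mult M (ae_class M (indicator A)) (E x)) (linf_one M)"
      using E[unfolded tp_normal_faithful_cond_exp_def conditional_expectation_def]
        ae_class_in_Linf[OF ind] Linf_pos_subset[OF linf_one_Linf_pos, of M] Linf_pos_subset[OF x]
      by blast
    ultimately show ?thesis by simp
  qed
  show "E x = E' x"
  proof (rule Linf_pos_eqI_trace)
    show "E x \<in> Linf_pos M" "E' x \<in> Linf_pos M"
      using E E' x by (simp_all add: tp_normal_faithful_cond_exp_def conditional_expectation_def)
  qed (simp_all add: assms tr)
qed fact

lemma tp_normal_faithful_cond_exp_cong:
  assumes E: "tp_normal_faithful_cond_exp M N J E" and eq: "\<And>x. x \<in> Linf N \<Longrightarrow> E' x = E x"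
    and J: "\<And>a. a \<in> Linf M \<Longrightarrow> J a \<in> Linf N"
  shows "tp_normal_faithful_cond_exp M N J E'"
proof -
  have "linf_linear N M E'"
    using E unfolding tp_normal_faithful_cond_exp_def conditional_expectation_def linf_linear_def
    by (simp add: eq linf_add_Linf linf_scale_Linf)
  moreover have "normal_map N M E'"
  proof -
    have "continuous_map (weak_star_topology N) (weak_star_topology M) E"
      using E by (simp add: tp_normal_faithful_cond_exp_def normal_map_def)
    then show ?thesis
      unfolding normal_map_def by (rule continuous_map_eq) (simp add: eq topspace_weak_star_topology)
  qed
  ultimately show ?thesis
    using E unfolding tp_normal_faithful_cond_exp_def conditional_expectation_def
      trace_preserving_def faithful_map_def
    by (simp add: eq J linf_mult_Linf Linf_pos_subset)
qed

section \<open>Averaging over the fibres of a product\<close>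

definition fibre_mean :: "'a measure \<Rightarrow> 'b measure \<Rightarrow> ('a \<times> 'b) linf \<Rightarrow> 'a linf" where
  "fibre_mean M P = on_class (\<lambda>g. ae_class M (\<lambda>x. \<integral>y. g (x, y) \<partial>P))"

locale fibred = M: sigma_finite_measure M + F: prob_space P
  for M :: "'a measure" and P :: "'b measure"
begin

sublocale pair_sigma_finite M P ..

abbreviation N :: "('a \<times> 'b) measure" where "N \<equiv> M \<Otimes>\<^sub>M P"

lemma distr_fst: "distr N M fst = M"
proof (rule measure_eqI)
  fix A assume "A \<in> sets (distr N M fst)"
  then have A: "A \<in> sets M" by simp
  have "fst -` A \<inter> space N = A \<times> space P"
    using sets.sets_into_space[OF A] by (auto simp: space_pair_measure)
  with A show "emeasure (distr N M fst) A = emeasure M A"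
    using F.emeasure_pair_measure_Times[OF A sets.top]
    by (simp add: emeasure_distr F.emeasure_space_1)
qed simp

lemma fibre_bound:
  assumes g: "g \<in> ess_bounded N"
  obtains C where "AE x in M. integrable P (\<lambda>y. g (x, y)) \<and> norm (\<integral>y. g (x, y) \<partial>P) \<le> C"
proof -
  from g obtain C where [measurable]: "g \<in> borel_measurable N"
    and C: "AE z in N. norm (g z) \<le> C" by (rule ess_boundedE)
  have "AE x in M. AE y in P. norm (g (x, y)) \<le> C" using C by (rule AE_pair)
  then have "AE x in M. integrable P (\<lambda>y. g (x, y)) \<and> norm (\<integral>y. g (x, y) \<partial>P) \<le> C"
    using AE_space
  proof eventually_elim
    case (elim x)
    then have [measurable]: "(\<lambda>y. g (x, y)) \<in> borel_measurable P" by measurable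
    have int: "integrable P (\<lambda>y. g (x, y))" using elim(1) by (rule F.integrable_const_bound) simp
    have "norm (\<integral>y. g (x, y) \<partial>P) \<le> (\<integral>y. norm (g (x, y)) \<partial>P)" by (rule integral_norm_bound)
    also have "\<dots> \<le> (\<integral>y. C \<partial>P)" using int elim(1) by (intro integral_mono_AE) auto
    finally show ?case using int by (simp add: F.prob_space)
  qed
  then show ?thesis by (rule that)
qed

lemma ess_bounded_fibre_mean:
  assumes g: "g \<in> ess_bounded N"
  shows "(\<lambda>x. \<integral>y. g (x, y) \<partial>P) \<in> ess_bounded M"
proof -
  note [measurable] = ess_bounded_measurable[OF g]
  from g obtain C where "AE x in M. integrable P (\<lambda>y. g (x, y)) \<and> norm (\<integral>y. g (x, y) \<partial>P) \<le> C"
    by (rule fibre_bound)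
  then have "AE x in M. norm (\<integral>y. g (x, y) \<partial>P) \<le> C" by (rule eventually_mono) simp
  then show ?thesis by (rule ess_boundedI[rotated]) simp
qed

lemma AE_integrable_fibre:
  assumes "g \<in> ess_bounded N"
  shows "AE x in M. integrable P (\<lambda>y. g (x, y))"
proof -
  from assms obtain C where "AE x in M. integrable P (\<lambda>y. g (x, y)) \<and> norm (\<integral>y. g (x, y) \<partial>P) \<le> C"
    by (rule fibre_bound)
  then show ?thesis by (rule eventually_mono) simp
qed

lemma fibre_mean_ae_class:
  assumes g: "g \<in> ess_bounded N"
  shows "fibre_mean M P (ae_class N g) = ae_class M (\<lambda>x. \<integral>y. g (x, y) \<partial>P)"
  unfolding fibre_mean_def
proof (rule on_class_ae_class[OF g])
  fix g' assume g': "g' \<in> ess_bounded N" "AE z in N. g' z = g z"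
  note [measurable] = ess_bounded_measurable[OF g] ess_bounded_measurable[OF g'(1)]
  from AE_pair[OF g'(2)] AE_space
  have "AE x in M. (\<integral>y. g' (x, y) \<partial>P) = (\<integral>y. g (x, y) \<partial>P)"
  proof eventually_elim
    case (elim x)
    then show ?case by (intro integral_cong_AE) auto
  qed
  then show "ae_class M (\<lambda>x. \<integral>y. g' (x, y) \<partial>P) = ae_class M (\<lambda>x. \<integral>y. g (x, y) \<partial>P)"
    by (rule ae_class_cong)
qed

lemma fibre_mean_linear: "linf_linear N M (fibre_mean M P)"
  unfolding linf_linear_def
proof (intro conjI ballI allI)
  fix a assume "a \<in> Linf N"
  then obtain f where f: "f \<in> ess_bounded N" "a = ae_class N f" by (rule LinfE)
  then show "fibre_mean M P a \<in> Linf M"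
    by (simp add: fibre_mean_ae_class ess_bounded_fibre_mean ae_class_in_Linf)
  show "fibre_mean M P (linf_scale N c a) = linf_scale M c (fibre_mean M P a)" for c
    using f by (simp add: fibre_mean_ae_class ess_bounded_fibre_mean linf_scale_ae_class
        ess_bounded_mult)
  fix b assume "b \<in> Linf N"
  then obtain g where g: "g \<in> ess_bounded N" "b = ae_class N g" by (rule LinfE)
  have "AE x in M. (\<integral>y. f (x, y) + g (x, y) \<partial>P) = (\<integral>y. f (x, y) \<partial>P) + (\<integral>y. g (x, y) \<partial>P)"
    using AE_integrable_fibre[OF f(1)] AE_integrable_fibre[OF g(1)] by eventually_elim simp
  then show "fibre_mean M P (linf_add N a b) = linf_add M (fibre_mean M P a) (fibre_mean M P b)"
    using f g by (simp add: fibre_mean_ae_class ess_bounded_fibre_mean linf_add_ae_class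
        ess_bounded_add ae_class_cong)
qed

lemma fibre_mean_pos:
  assumes f: "f \<in> ess_bounded N" "AE z in N. f z \<in> \<real>\<^sub>\<ge>\<^sub>0"
  shows "AE x in M. (\<integral>y. f (x, y) \<partial>P) \<in> \<real>\<^sub>\<ge>\<^sub>0 \<and>
      ennreal (Re (\<integral>y. f (x, y) \<partial>P)) = (\<integral>\<^sup>+y. ennreal (Re (f (x, y))) \<partial>P)"
  using AE_pair[OF f(2)] AE_integrable_fibre[OF f(1)]
proof eventually_elim
  case (elim x)
  have nonneg: "AE y in P. 0 \<le> Re (f (x, y))" and Im: "AE y in P. Im (f (x, y)) = 0"
    using elim(1) by (auto simp: complex_nonneg_Reals_iff elim: eventually_mono)
  have "Im (\<integral>y. f (x, y) \<partial>P) = (\<integral>y. Im (f (x, y)) \<partial>P)"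
    using elim(2) by (rule integral_Im[symmetric])
  also have "\<dots> = (\<integral>y. 0 \<partial>P)"
    using Im borel_measurable_integrable[OF elim(2)] by (intro integral_cong_AE) simp_all
  finally have "Im (\<integral>y. f (x, y) \<partial>P) = 0" by simp
  moreover have "0 \<le> Re (\<integral>y. f (x, y) \<partial>P)"
    using integral_nonneg_AE[OF nonneg] elim(2) by simp
  moreover have "ennreal (Re (\<integral>y. f (x, y) \<partial>P)) = (\<integral>\<^sup>+y. ennreal (Re (f (x, y))) \<partial>P)"
    using nn_integral_eq_integral[OF integrable_Re[OF elim(2)] nonneg] elim(2) by simp
  ultimately show ?case by (simp add: complex_nonneg_Reals_iff)
qed

lemma fibre_mean_trace: "trace_preserving N M (fibre_mean M P)"
  unfolding trace_preserving_def
proof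
  fix a assume "a \<in> Linf_pos N"
  then obtain f where f: "f \<in> ess_bounded N" "a = ae_class N f" "AE z in N. f z \<in> \<real>\<^sub>\<ge>\<^sub>0"
    by (rule Linf_posE)
  note [measurable] = ess_bounded_measurable[OF f(1)]
  have "(\<integral>\<^sup>+x. ennreal (Re (\<integral>y. f (x, y) \<partial>P)) \<partial>M) = (\<integral>\<^sup>+x. \<integral>\<^sup>+y. ennreal (Re (f (x, y))) \<partial>P \<partial>M)"
    using fibre_mean_pos[OF f(1,3)] by (intro nn_integral_cong_AE) (auto elim: eventually_mono)
  also have "\<dots> = (\<integral>\<^sup>+z. ennreal (Re (f z)) \<partial>N)"
    by (rule F.nn_integral_fst) simp
  finally show "linf_trace M (fibre_mean M P a) = linf_trace N a"
    using f(1) by (simp add: f(2) fibre_mean_ae_class linf_trace_ae_class ess_bounded_fibre_mean)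
qed

lemma fibre_mean_Linf_pos: "a \<in> Linf_pos N \<Longrightarrow> fibre_mean M P a \<in> Linf_pos M"
proof (erule Linf_posE)
  fix f assume f: "f \<in> ess_bounded N" "a = ae_class N f" "AE z in N. f z \<in> \<real>\<^sub>\<ge>\<^sub>0"
  have "AE x in M. (\<integral>y. f (x, y) \<partial>P) \<in> \<real>\<^sub>\<ge>\<^sub>0"
    using fibre_mean_pos[OF f(1,3)] by (rule eventually_mono) simp
  then show "fibre_mean M P a \<in> Linf_pos M"
    unfolding f(2) fibre_mean_ae_class[OF f(1)]
    by (intro ae_class_Linf_pos ess_bounded_fibre_mean f(1))
qed

text \<open>A positive element with vanishing mean has trace zero, because averaging preserves
  the trace.\<close>

lemma fibre_mean_faithful: "faithful_map N M (fibre_mean M P)"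
  unfolding faithful_map_def
proof (intro ballI impI)
  fix a assume a: "a \<in> Linf_pos N" and zero: "fibre_mean M P a = linf_zero M"
  from a obtain f where f: "f \<in> ess_bounded N" "a = ae_class N f" "AE z in N. f z \<in> \<real>\<^sub>\<ge>\<^sub>0"
    by (rule Linf_posE)
  note [measurable] = ess_bounded_measurable[OF f(1)]
  have "(\<integral>\<^sup>+z. ennreal (Re (f z)) \<partial>N) = linf_trace M (linf_zero M)"
    using fibre_mean_trace a f(1) unfolding trace_preserving_def zero[symmetric]
    by (simp add: f(2) linf_trace_ae_class)
  also have "\<dots> = 0" by (simp add: linf_zero_def linf_trace_ae_class)
  finally have "AE z in N. ennreal (Re (f z)) = 0"
    by (subst (asm) nn_integral_0_iff_AE) simp_all
  then have "AE z in N. f z = 0"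
    using f(3) by eventually_elim (auto simp: complex_nonneg_Reals_iff complex_eq_iff)
  then show "a = linf_zero N" unfolding f(2) linf_zero_def by (rule ae_class_cong)
qed

text \<open>The preadjoint of averaging sends \<open>h\<close> to \<open>h \<otimes> 1\<close>, and that of \<open>f \<mapsto> f \<otimes> 1\<close> integrates out
  the second variable; both duality relations are Fubini's theorem.\<close>

lemma fibre_mean_normal: "normal_map N M (fibre_mean M P)"
proof (rule normal_mapI)
  show "fibre_mean M P a \<in> Linf M" if "a \<in> Linf N" for a
    using that fibre_mean_linear by (simp add: linf_linear_def)
  fix h :: "'a \<Rightarrow> complex" assume h: "integrable M h"
  note [measurable] = borel_measurable_integrable[OF h]
  have "integrable (distr N M fst) h" using h by (simp add: distr_fst)
  then have h': "integrable N (\<lambda>z. h (fst z))" by (rule integrable_distr[rotated]) simp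
  have "linf_pairing M h (fibre_mean M P a) = linf_pairing N (\<lambda>z. h (fst z)) a"
    if "a \<in> Linf N" for a
  proof -
    from that obtain f where f: "f \<in> ess_bounded N" "a = ae_class N f" by (rule LinfE)
    have "(\<integral>z. h (fst z) * f z \<partial>N) = (\<integral>x. \<integral>y. h x * f (x, y) \<partial>P \<partial>M)"
      using integral_fst'[OF integrable_mult_ess_bounded[OF h' f(1)]] by simp
    then show ?thesis
      using f h h' by (simp add: fibre_mean_ae_class ess_bounded_fibre_mean linf_pairing_ae_class)
  qed
  with h' show "\<exists>h'. integrable N h' \<and>
      (\<forall>a\<in>Linf N. linf_pairing M h (fibre_mean M P a) = linf_pairing N h' a)" by blast
qed

end

locale fibred_koopman = fibred M P + koopman M "M \<Otimes>\<^sub>M P" fst K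
  for M :: "'a measure" and P :: "'b measure" and K :: "'a linf \<Rightarrow> ('a \<times> 'b) linf"
begin

lemma K_normal: "normal_map M N K"
proof (rule normal_mapI)
  fix h :: "'a \<times> 'b \<Rightarrow> complex" assume h: "integrable N h"
  have h': "integrable M (\<lambda>x. \<integral>y. h (x, y) \<partial>P)" using h by (rule integrable_fst')
  have "linf_pairing N h (K a) = linf_pairing M (\<lambda>x. \<integral>y. h (x, y) \<partial>P) a" if "a \<in> Linf M" for a
  proof -
    from that obtain f where f: "f \<in> ess_bounded M" "a = ae_class M f" by (rule LinfE)
    have "(\<integral>z. h z * f (fst z) \<partial>N) = (\<integral>x. \<integral>y. h (x, y) * f x \<partial>P \<partial>M)"
      using integral_fst'[OF integrable_mult_ess_bounded[OF h ess_bounded_T[OF f(1)]]] by simp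
    then show ?thesis
      using f h h' by (simp add: K ess_bounded_T linf_pairing_ae_class)
  qed
  with h' show "\<exists>h'. integrable M h' \<and> (\<forall>a\<in>Linf M. linf_pairing N h (K a) = linf_pairing M h' a)"
    by blast
qed (rule K_Linf)

lemma fibre_mean_K:
  assumes "a \<in> Linf M" shows "fibre_mean M P (K a) = a"
  using assms
  by (auto elim!: LinfE simp: K fibre_mean_ae_class[OF ess_bounded_T] F.prob_space)

lemma fibre_mean_cond_exp: "tp_normal_faithful_cond_exp M N K (fibre_mean M P)"
  unfolding tp_normal_faithful_cond_exp_def conditional_expectation_def
proof (intro conjI ballI)
  fix a b x assume "a \<in> Linf M" "b \<in> Linf M" "x \<in> Linf N"
  then obtain f g u where f: "f \<in> ess_bounded M" "a = ae_class M f"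
    and g: "g \<in> ess_bounded M" "b = ae_class M g"
    and u: "u \<in> ess_bounded N" "x = ae_class N u" by (metis LinfE)
  show "fibre_mean M P (linf_mult N (linf_mult N (K a) x) (K b)) =
      linf_mult M (linf_mult M a (fibre_mean M P x)) b"
    using f(1) g(1) u(1)
    by (simp add: f(2) g(2) u(2) K linf_mult_ae_class fibre_mean_ae_class ess_bounded_fibre_mean
        ess_bounded_T ess_bounded_mult)
qed (simp_all add: fibre_mean_linear fibre_mean_Linf_pos fibre_mean_K fibre_mean_trace
    fibre_mean_normal fibre_mean_faithful)

end

section \<open>The Poisson kernel\<close>

lemma nn_integral_gaussian:
  assumes s: "s > 0"
  shows "(\<integral>\<^sup>+x. ennreal (exp (- s * (norm x)\<^sup>2)) \<partial>(lborel :: 'a::euclidean_space measure)) =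
    ennreal ((pi / s) powr (real DIM('a) / 2))"
proof -
  have one_dim: "(\<integral>\<^sup>+x. ennreal (exp (- s * x\<^sup>2)) \<partial>lborel) = ennreal (sqrt (pi / s))"
  proof -
    \<comment> \<open>the standard deviation for which \<open>exp (- s x\<^sup>2)\<close> is proportional to a normal density\<close>
    define \<sigma> where "\<sigma> = 1 / sqrt (2 * s)"
    have \<sigma>: "\<sigma> > 0" "2 * \<sigma>\<^sup>2 = 1 / s" using s by (simp_all add: \<sigma>_def power_divide)
    have density: "exp (- s * x\<^sup>2) = sqrt (pi / s) * normal_density 0 \<sigma> x" for x
    proof -
      have "2 * pi * \<sigma>\<^sup>2 = pi / s" using \<sigma>(2) by (simp add: algebra_simps)
      then show ?thesis using \<sigma>(2) s by (simp add: normal_density_def)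
    qed
    have "(\<integral>\<^sup>+x. ennreal (normal_density 0 \<sigma> x) \<partial>lborel) = 1"
      using \<sigma>(1) by (subst nn_integral_eq_integral)
        (auto intro!: integrable_normal_density simp: integral_normal_density)
    then show ?thesis
      unfolding density using s by (simp add: ennreal_mult nn_integral_cmult)
  qed
  have "(\<integral>\<^sup>+x. ennreal (exp (- s * (norm x)\<^sup>2)) \<partial>(lborel :: 'a measure)) =
      (\<integral>\<^sup>+x. (\<Prod>b\<in>Basis. ennreal (exp (- s * (x \<bullet> b)\<^sup>2))) \<partial>(lborel :: 'a measure))"
  proof (rule nn_integral_cong)
    fix x :: 'a
    have "(norm x)\<^sup>2 = (\<Sum>b\<in>Basis. (x \<bullet> b)\<^sup>2)"
      unfolding power2_norm_eq_inner euclidean_inner[of x x] by (simp add: power2_eq_square)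
    then show "ennreal (exp (- s * (norm x)\<^sup>2)) = (\<Prod>b\<in>Basis. ennreal (exp (- s * (x \<bullet> b)\<^sup>2)))"
      by (simp add: sum_distrib_left exp_sum prod_ennreal flip: sum_negf)
  qed
  also have "\<dots> = (\<Prod>b\<in>(Basis :: 'a set). (\<integral>\<^sup>+x. ennreal (exp (- s * x\<^sup>2)) \<partial>lborel))"
    by (rule nn_integral_lborel_prod) simp_all
  also have "\<dots> = ennreal (sqrt (pi / s)) ^ DIM('a)"
    unfolding one_dim by simp
  also have "\<dots> = ennreal ((pi / s) powr (real DIM('a) / 2))"
    using s by (simp add: ennreal_power powr_half_sqrt[symmetric] powr_powr flip: powr_realpow)
  finally show ?thesis .
qed

lemma nn_integral_Gamma_scaled:
  fixes a c :: real
  assumes a: "a > 0" and c: "c > 0"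
  shows "(\<integral>\<^sup>+s. ennreal (indicator {0..} s * s powr (a - 1) * exp (- c * s)) \<partial>lborel) =
    ennreal (Gamma a * c powr (- a))"
proof -
  have "ennreal (Gamma a) =
      ennreal c * (\<integral>\<^sup>+s. ennreal (indicator {0..} (c * s) * (c * s) powr (a - 1) / exp (c * s)) \<partial>lborel)"
    using c by (subst Gamma_conv_nn_integral_real[OF a], subst nn_integral_real_affine[of _ c 0]) auto
  also have "\<dots> = (\<integral>\<^sup>+s. ennreal (c powr a) *
      ennreal (indicator {0..} s * s powr (a - 1) * exp (- c * s)) \<partial>lborel)"
  proof (subst nn_integral_cmult[symmetric], measurable, rule nn_integral_cong)
    fix s :: real
    show "ennreal c * ennreal (indicator {0..} (c * s) * (c * s) powr (a - 1) / exp (c * s)) =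
        ennreal (c powr a) * ennreal (indicator {0..} s * s powr (a - 1) * exp (- c * s))"
    proof (cases "s \<ge> 0")
      case True
      have "c * c powr (a - 1) = c powr a" using c by (simp add: powr_diff)
      then show ?thesis
        using c True by (simp add: powr_mult exp_minus field_simps flip: ennreal_mult)
    next
      case False
      with c show ?thesis by (simp add: indicator_def zero_le_mult_iff)
    qed
  qed
  also have "\<dots> = ennreal (c powr a) *
      (\<integral>\<^sup>+s. ennreal (indicator {0..} s * s powr (a - 1) * exp (- c * s)) \<partial>lborel)"
    by (rule nn_integral_cmult) measurable
  finally have "ennreal (c powr (- a)) * ennreal (Gamma a) = ennreal (c powr (- a)) * ennreal (c powr a) *
      (\<integral>\<^sup>+s. ennreal (indicator {0..} s * s powr (a - 1) * exp (- c * s)) \<partial>lborel)"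
    by (simp add: mult.assoc)
  moreover have "ennreal (c powr (- a)) * ennreal (c powr a) = 1"
    using c by (simp add: powr_minus flip: ennreal_mult)
  ultimately show ?thesis
    using Gamma_real_pos[OF a] by (simp add: mult.commute flip: ennreal_mult)
qed

text \<open>Subordination: \<open>\<Gamma>(a) (1 + \<bar>x\<bar>\<^sup>2)\<^sup>-\<^sup>a = \<integral>\<^sub>0\<^sup>\<infinity> s\<^bsup>a-1\<^esup> e\<^bsup>-s\<^esup> e\<^bsup>-s\<bar>x\<bar>\<^sup>2\<^esup> ds\<close> writes the kernel as a mixture of
  Gaussians; integrating each Gaussian first leaves \<open>\<pi>\<^bsup>n/2\<^esup> \<Gamma>(1/2)\<close> when \<open>a = (n + 1)/2\<close>.\<close>

lemma nn_integral_poisson_profile: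
  defines "a \<equiv> (real DIM('a::euclidean_space) + 1) / 2"
  shows "(\<integral>\<^sup>+x. ennreal ((1 + (norm x)\<^sup>2) powr (- a)) \<partial>(lborel :: 'a measure)) =
    ennreal (pi powr a / Gamma a)"
proof -
  let ?G = "\<lambda>s. indicator {0..} s * s powr (a - 1) * exp (- s) :: real"
  have a: "a > 0" by (simp add: a_def add_nonneg_pos)
  have "ennreal (Gamma a) * (\<integral>\<^sup>+x. ennreal ((1 + (norm x)\<^sup>2) powr (- a)) \<partial>(lborel :: 'a measure)) =
      (\<integral>\<^sup>+x. ennreal (Gamma a * (1 + (norm x)\<^sup>2) powr (- a)) \<partial>(lborel :: 'a measure))"
    using Gamma_real_pos[OF a] by (simp add: ennreal_mult nn_integral_cmult)
  also have "\<dots> = (\<integral>\<^sup>+x. \<integral>\<^sup>+s. ennreal (?G s) * ennreal (exp (- s * (norm x)\<^sup>2)) \<partial>lborel \<partial>(lborel :: 'a measure))"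
  proof (rule nn_integral_cong)
    fix x :: 'a
    have "1 + (norm x)\<^sup>2 > 0" by (simp add: add_pos_nonneg)
    moreover have "exp (- (1 + (norm x)\<^sup>2) * s) = exp (- s) * exp (- s * (norm x)\<^sup>2)" for s :: real
      by (simp add: algebra_simps flip: exp_add)
    ultimately show "ennreal (Gamma a * (1 + (norm x)\<^sup>2) powr (- a)) =
        (\<integral>\<^sup>+s. ennreal (?G s) * ennreal (exp (- s * (norm x)\<^sup>2)) \<partial>lborel)"
      by (simp add: mult.assoc flip: nn_integral_Gamma_scaled[OF a] ennreal_mult)
  qed
  also have "\<dots> = (\<integral>\<^sup>+s. \<integral>\<^sup>+x. ennreal (?G s) * ennreal (exp (- s * (norm x)\<^sup>2)) \<partial>(lborel :: 'a measure) \<partial>lborel)"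
    by (rule lborel_pair.Fubini'[symmetric]) measurable
  also have "\<dots> = (\<integral>\<^sup>+s. ennreal (pi powr (real DIM('a) / 2)) *
      ennreal (indicator {0..} s * s powr (1/2 - 1) * exp (- 1 * s)) \<partial>lborel)"
  proof (rule nn_integral_cong)
    fix s :: real
    show "(\<integral>\<^sup>+x. ennreal (?G s) * ennreal (exp (- s * (norm x)\<^sup>2)) \<partial>(lborel :: 'a measure)) =
      ennreal (pi powr (real DIM('a) / 2)) * ennreal (indicator {0..} s * s powr (1/2 - 1) * exp (- 1 * s))"
    \<comment> \<open>at \<open>s = 0\<close> both sides vanish, because \<open>0 powr b = 0\<close>\<close>
    proof (cases "s > 0")
      case True
      have "s powr (a - 1) * (pi / s) powr (real DIM('a) / 2) =
          pi powr (real DIM('a) / 2) * s powr (1/2 - 1)"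
      proof -
        have "a - 1 - real DIM('a) / 2 = 1/2 - 1" by (simp add: a_def field_simps)
        then have "s powr (a - 1) / s powr (real DIM('a) / 2) = s powr (1/2 - 1)"
          by (simp add: powr_diff[symmetric])
        then show ?thesis using True by (simp add: powr_divide field_simps)
      qed
      moreover have "(\<integral>\<^sup>+x. ennreal (?G s) * ennreal (exp (- s * (norm x)\<^sup>2)) \<partial>(lborel :: 'a measure)) =
          ennreal (?G s) * ennreal ((pi / s) powr (real DIM('a) / 2))"
        by (subst nn_integral_cmult) (simp_all only: nn_integral_gaussian[OF True], measurable)
      ultimately show ?thesis
        using True by (simp add: mult_ac flip: ennreal_mult)
    qed (cases "s = 0", simp_all)
  qed
  also have "\<dots> = ennreal (pi powr (real DIM('a) / 2)) * ennreal (Gamma (1/2) * 1 powr (- (1/2)))"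
    by (subst nn_integral_cmult, measurable, subst nn_integral_Gamma_scaled) simp_all
  also have "\<dots> = ennreal (pi powr a)"
    by (simp add: Gamma_one_half_real a_def powr_half_sqrt[symmetric] add_divide_distrib powr_add
        flip: ennreal_mult)
  finally have "ennreal (inverse (Gamma a)) * ennreal (Gamma a) *
      (\<integral>\<^sup>+x. ennreal ((1 + (norm x)\<^sup>2) powr (- a)) \<partial>(lborel :: 'a measure)) =
      ennreal (inverse (Gamma a)) * ennreal (pi powr a)"
    by (simp add: mult.assoc)
  moreover have "ennreal (inverse (Gamma a)) * ennreal (Gamma a) = 1"
    using Gamma_real_pos[OF a] by (simp flip: ennreal_mult)
  ultimately show ?thesis
    using Gamma_real_pos[OF a] by (simp add: divide_inverse mult.commute flip: ennreal_mult)
qed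

lemma sphere_area_pos: "sphere_area (Suc m) > 0"
  unfolding sphere_area_def by (intro divide_pos_pos mult_pos_pos Gamma_real_pos) auto

lemma prob_space_poisson:
  "prob_space (density lborel (\<lambda>y :: real ^ 'n. ennreal (poisson_kernel 1 y)))"
proof (rule prob_spaceI)
  define a where "a = (real CARD('n) + 1) / 2"
  have a: "Gamma a > 0" by (rule Gamma_real_pos) (simp add: a_def add_nonneg_pos)
  have kernel: "poisson_kernel 1 y = Gamma a / pi powr a * (1 + (norm y)\<^sup>2) powr (- a)" for y :: "real ^ 'n"
    using a by (simp add: poisson_kernel_def sphere_area_def a_def powr_minus field_simps)
  have "(\<integral>\<^sup>+y. ennreal (poisson_kernel 1 y) \<partial>(lborel :: (real ^ 'n) measure)) =
      ennreal (Gamma a / pi powr a) * ennreal (pi powr a / Gamma a)"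
    unfolding kernel
    using a nn_integral_poisson_profile[where 'a = "real ^ 'n"]
    by (subst ennreal_mult, simp, simp, subst nn_integral_cmult, simp, simp add: a_def)
  also have "\<dots> = 1" using a by (simp flip: ennreal_mult)
  finally show "emeasure (density lborel (\<lambda>y :: real ^ 'n. ennreal (poisson_kernel 1 y)))
      (space (density lborel (\<lambda>y :: real ^ 'n. ennreal (poisson_kernel 1 y)))) = 1"
    by (simp add: emeasure_density poisson_kernel_def)
qed

text \<open>The substitution \<open>y = t z\<close> has Jacobian \<open>t\<^sup>n\<close>, which matches the homogeneity of degree \<open>-n\<close> of
  the kernel in \<open>(t, y)\<close>.\<close>

lemma integral_poisson_kernel_dilation:
  fixes f :: "real ^ 'n \<Rightarrow> complex"
  assumes t: "t > 0" and [measurable]: "f \<in> borel_measurable borel"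
  shows "(\<integral>y. complex_of_real (poisson_kernel t y) * f y \<partial>lborel) =
    (\<integral>z. f (t *\<^sub>R z) \<partial>(density lborel (\<lambda>y. ennreal (poisson_kernel 1 y))))"
proof -
  define a where "a = (real CARD('n) + 1) / 2"
  have pk_meas[measurable]: "(poisson_kernel s :: real ^ 'n \<Rightarrow> real) \<in> borel_measurable borel" for s
    unfolding poisson_kernel_def[abs_def] by measurable
  have scale: "t ^ CARD('n) * poisson_kernel t (t *\<^sub>R z) = poisson_kernel 1 z" for z :: "real ^ 'n"
  proof -
    have "(t\<^sup>2 + (norm (t *\<^sub>R z))\<^sup>2) powr a = (t\<^sup>2 * (1 + (norm z)\<^sup>2)) powr a"
      using t by (simp add: power_mult_distrib algebra_simps)
    also have "\<dots> = (t\<^sup>2) powr a * (1 + (norm z)\<^sup>2) powr a"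
      by (rule powr_mult)
    also have "(t\<^sup>2) powr a = t ^ (CARD('n) + 1)"
    proof -
      have "(t\<^sup>2) powr a = (t powr 2) powr a" using t by simp
      also have "\<dots> = t powr (2 * a)" by (rule powr_powr)
      also have "2 * a = real (CARD('n) + 1)" by (simp add: a_def)
      also have "t powr real (CARD('n) + 1) = t ^ (CARD('n) + 1)" using t by (rule powr_realpow)
      finally show ?thesis .
    qed
    finally show ?thesis
      using t by (simp add: poisson_kernel_def a_def field_simps)
  qed
  have "(\<integral>y. complex_of_real (poisson_kernel t y) * f y \<partial>lborel) =
      (\<integral>y. complex_of_real (poisson_kernel t y) * f y
        \<partial>(density (distr lborel borel (\<lambda>x. 0 + t *\<^sub>R x)) (\<lambda>_. \<bar>t\<bar> ^ DIM(real ^ 'n))))"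
    using t by (subst (1) lborel_affine[of t 0]) (rule less_imp_neq[symmetric], simp_all)
  also have "\<dots> = (\<integral>z. t ^ CARD('n) *\<^sub>R (complex_of_real (poisson_kernel t (t *\<^sub>R z)) * f (t *\<^sub>R z)) \<partial>lborel)"
    using t by (simp add: integral_density integral_distr)
  also have "\<dots> = (\<integral>z. poisson_kernel 1 z *\<^sub>R f (t *\<^sub>R z) \<partial>lborel)"
    unfolding scale[symmetric] by (simp add: scaleR_conv_of_real mult.assoc)
  also have "\<dots> = (\<integral>z. f (t *\<^sub>R z) \<partial>(density lborel (\<lambda>y. ennreal (poisson_kernel 1 y))))"
    by (rule integral_density[symmetric])
      (use sphere_area_pos[of "CARD('n)"] in \<open>auto simp: poisson_kernel_def\<close>)
  finally show ?thesis .
qed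

section \<open>An induction principle for integrable functions on Euclidean space\<close>

text \<open>Indicators of compact sets are dominated limits of \<open>max 0 (1 - n dist(x, K))\<close>; since the closed sets are a
  \<open>\<pi>\<close>-system generating the Borel sets, Dynkin's lemma inside a fixed ball passes to indicators of
  bounded Borel sets, and limits along growing balls remove the boundedness.\<close>

lemma integrable_induct_continuous:
  fixes f :: "'a::euclidean_space \<Rightarrow> 'b::{banach, second_countable_topology}"
  assumes sets_M: "sets M = sets borel" and fin: "\<And>S. compact S \<Longrightarrow> emeasure M S < \<infinity>"
    and f: "integrable M f"
    and cont: "\<And>g. continuous_on UNIV g \<Longrightarrow> bounded {x. g x \<noteq> 0} \<Longrightarrow> P g"
    and add: "\<And>f g. integrable M f \<Longrightarrow> P f \<Longrightarrow> integrable M g \<Longrightarrow> P g \<Longrightarrow> P (\<lambda>x. f x + g x)"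
    and lim: "\<And>s w f. (\<And>i. integrable M (s i)) \<Longrightarrow> (\<And>i. P (s i)) \<Longrightarrow> integrable M f \<Longrightarrow>
      integrable M (w :: 'a \<Rightarrow> real) \<Longrightarrow> (\<And>x. (\<lambda>i. s i x) \<longlonglongrightarrow> f x) \<Longrightarrow>
      (\<And>i x. norm (s i x) \<le> w x) \<Longrightarrow> P f"
  shows "P f"
proof -
  note [measurable_cong] = sets_M
  have space_M: "space M = UNIV" using sets_eq_imp_space_eq[OF sets_M] by simp
  have int_ind: "integrable M (\<lambda>x. indicator A x *\<^sub>R c)"
    if "A \<in> sets borel" "A \<subseteq> S" "compact S" for A S and c :: "'c::{banach, second_countable_topology}"
  proof -
    have "emeasure M A \<le> emeasure M S"
      using that by (intro emeasure_mono) (auto simp: sets_M borel_compact)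
    with fin[OF that(3)] have "emeasure M A < \<infinity>" by (rule le_less_trans[rotated])
    with that(1) show ?thesis by (intro integrable_scaleR_left integrable_real_indicator) (auto simp: sets_M)
  qed
  have compact: "P (\<lambda>x. indicator K x *\<^sub>R c)" if K: "compact K" for K c
  proof (cases "K = {}")
    case True
    then show ?thesis using cont[of "\<lambda>x. 0"] by simp
  next
    case False
    from K have "closed K" by (rule compact_imp_closed)
    from compact_imp_bounded[OF K] obtain R where R: "\<And>k. k \<in> K \<Longrightarrow> norm k \<le> R"
      by (auto simp: bounded_iff)
    define s where "s i x = max 0 (1 - real (Suc i) * infdist x K) *\<^sub>R c" for i x
    have supp: "x \<in> cball 0 (R + 1)" if "s i x \<noteq> 0" for i x
    proof -
      from that have "real (Suc i) * infdist x K < 1" by (auto simp: s_def max_def split: if_splits)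
      moreover have "infdist x K \<le> real (Suc i) * infdist x K"
        using infdist_nonneg[of x K] by (simp add: mult_le_cancel_right1)
      ultimately have "infdist x K < 1" by simp
      moreover obtain k where k: "k \<in> K" "infdist x K = dist x k"
        using infdist_attains_inf[OF \<open>closed K\<close> False] by blast
      moreover have "norm k \<le> R" using k(1) by (rule R)
      moreover have "norm x \<le> norm k + dist x k"
        by (metis add.commute dist_norm norm_triangle_sub)
      ultimately show ?thesis by simp
    qed
    have s_cont: "continuous_on UNIV (s i)" for i
      unfolding s_def by (intro continuous_intros)
    have [measurable]: "s i \<in> borel_measurable borel" for i
      using s_cont by (rule borel_measurable_continuous_onI)
    have bound: "norm (s i x) \<le> indicator (cball 0 (R + 1)) x *\<^sub>R norm c" for i x
    proof (cases "s i x = 0")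
      case False
      have "0 \<le> real (Suc i) * infdist x K" by (simp add: infdist_nonneg)
      then have "norm (s i x) \<le> 1 * norm c"
        unfolding s_def norm_scaleR by (intro mult_right_mono) auto
      with supp[OF False] show ?thesis by simp
    qed simp
    have w: "integrable M (\<lambda>x. indicator (cball 0 (R + 1)) x *\<^sub>R norm c)"
      by (rule int_ind[OF _ subset_refl]) auto
    show ?thesis
    proof (rule lim[OF _ _ _ w _ bound])
      show "integrable M (s i)" for i
        by (rule Bochner_Integration.integrable_bound[OF w])
          (use bound in \<open>auto simp: sets_M intro: order_trans[OF bound]\<close>)
      show "P (s i)" for i
        by (rule cont[OF s_cont], rule bounded_subset[OF bounded_cball[of 0 "R + 1"]]) (use supp in blast)
      show "integrable M (\<lambda>x. indicator K x *\<^sub>R c)"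
        using K by (intro int_ind[OF _ subset_refl]) (auto simp: borel_compact)
      show "(\<lambda>i. s i x) \<longlonglongrightarrow> indicator K x *\<^sub>R c" for x
      proof (cases "x \<in> K")
        case True
        then show ?thesis by (simp add: s_def)
      next
        case False
        with \<open>closed K\<close> \<open>K \<noteq> {}\<close> have d: "infdist x K > 0" by (rule infdist_pos_not_in_closed)
        obtain n where n: "1 / infdist x K < real n" using reals_Archimedean2 by blast
        have "s i x = 0" if "i \<ge> n" for i
        proof -
          have "1 / infdist x K \<le> real (Suc i)" using n that by simp
          then have "1 \<le> real (Suc i) * infdist x K" using d by (simp add: pos_divide_le_eq)
          then show ?thesis by (simp add: s_def)
        qed
        then have "eventually (\<lambda>i. s i x = indicator K x *\<^sub>R c) sequentially"
          using False by (auto simp: eventually_sequentially)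
        then show ?thesis by (rule tendsto_eventually)
      qed
    qed
  qed
  have bounded: "P (\<lambda>x. indicator (A \<inter> cball 0 R) x *\<^sub>R c)" if "A \<in> sets borel" for A R c
  proof -
    let ?B = "cball 0 R :: 'a set"
    have int: "integrable M (\<lambda>x. indicator (A \<inter> ?B) x *\<^sub>R c)"
      if "A \<in> sets borel" for A and c :: "'c::{banach, second_countable_topology}"
      by (rule int_ind[OF _ _ compact_cball[of 0 R]]) (use that in auto)
    have "Int_stable (Collect closed :: 'a set set)" by (auto simp: Int_stable_def)
    moreover have "Collect closed \<subseteq> Pow (UNIV :: 'a set)" by simp
    moreover have "A \<in> sigma_sets UNIV (Collect closed)"
      using that by (simp add: borel_eq_closed)
    ultimately have "\<forall>c. P (\<lambda>x. indicator (A \<inter> ?B) x *\<^sub>R c)"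
    proof (induction rule: sigma_sets_induct_disjoint)
      case (basic A)
      then show ?case by (auto intro!: compact closed_Int_compact)
    next
      case empty
      show ?case using compact[of "{}"] by simp
    next
      case (compl A)
      have A: "A \<in> sets borel" using compl(1) by (simp add: borel_eq_closed)
      show ?case
      proof
        fix c :: 'b
        have "P (\<lambda>x. indicator ?B x *\<^sub>R c + indicator (A \<inter> ?B) x *\<^sub>R (- c))"
          using int[of UNIV c] int[OF A, of "- c"] compl(2)[rule_format, of "- c"] compact[of ?B c]
          by (intro add) auto
        also have "(\<lambda>x. indicator ?B x *\<^sub>R c + indicator (A \<inter> ?B) x *\<^sub>R (- c)) =
            (\<lambda>x. indicator ((UNIV - A) \<inter> ?B) x *\<^sub>R c)"
          by (auto simp: fun_eq_iff indicator_def)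
        finally show "P (\<lambda>x. indicator ((UNIV - A) \<inter> ?B) x *\<^sub>R c)" .
      qed
    next
      case (union A)
      have A: "A i \<in> sets borel" for i using union(2) by (auto simp: borel_eq_closed)
      show ?case
      proof
        fix c :: 'b
        let ?s = "\<lambda>n x. indicator ((\<Union>i<n. A i) \<inter> ?B) x *\<^sub>R c"
        have s: "P (?s n)" for n
        proof (induction n)
          case 0
          show ?case using compact[of "{}"] by simp
        next
          case (Suc n)
          have "(\<Union>i<n. A i) \<inter> A n = {}"
            using union(1) unfolding disjoint_family_on_def by (auto dest!: less_imp_neq)
          then have "?s (Suc n) = (\<lambda>x. ?s n x + indicator (A n \<inter> ?B) x *\<^sub>R c)"
            by (auto simp: fun_eq_iff indicator_def less_Suc_eq)
          moreover have "P (\<lambda>x. ?s n x + indicator (A n \<inter> ?B) x *\<^sub>R c)"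
            using Suc union(3) A by (intro add int) auto
          ultimately show ?case by simp
        qed
        show "P (\<lambda>x. indicator ((\<Union>i. A i) \<inter> ?B) x *\<^sub>R c)"
        proof (rule lim[where s = ?s and w = "\<lambda>x. indicator (UNIV \<inter> ?B) x *\<^sub>R norm c"])
          show "(\<lambda>n. ?s n x) \<longlonglongrightarrow> indicator ((\<Union>i. A i) \<inter> ?B) x *\<^sub>R c" for x
          proof (rule tendsto_eventually)
            show "\<forall>\<^sub>F n in sequentially. ?s n x = indicator ((\<Union>i. A i) \<inter> ?B) x *\<^sub>R c"
            proof (cases "\<exists>i. x \<in> A i")
              case True
              then obtain i where "x \<in> A i" ..
              then show ?thesis
                by (intro eventually_sequentiallyI[of "Suc i"]) (auto simp: indicator_def)
            qed (auto simp: indicator_def)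
          qed
          show "integrable M (?s n)" for n by (rule int) (use A in auto)
          show "integrable M (\<lambda>x. indicator ((\<Union>i. A i) \<inter> ?B) x *\<^sub>R c)"
            by (rule int) (use A in auto)
          show "integrable M (\<lambda>x. indicator (UNIV \<inter> ?B) x *\<^sub>R norm c)" by (rule int) simp
        qed (rule s, simp add: indicator_def)
      qed
    qed
    then show ?thesis ..
  qed
  show ?thesis
    using f
  proof (induction rule: integrable_induct)
    case (base A c)
    then have A: "A \<in> sets borel" by (simp add: sets_M)
    have int: "integrable M (\<lambda>x. indicator A x *\<^sub>R c)"
      for c :: "'c::{banach, second_countable_topology}"
      using base by (intro integrable_scaleR_left integrable_real_indicator) auto
    let ?s = "\<lambda>n x. indicator (A \<inter> cball 0 (real n)) x *\<^sub>R c"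
    show ?case
    proof (rule lim[where s = ?s and w = "\<lambda>x. indicator A x *\<^sub>R norm c"])
      show "integrable M (?s n)" for n
        by (rule int_ind[OF _ _ compact_cball[of 0 "real n"]]) (use A in auto)
      show "(\<lambda>n. ?s n x) \<longlonglongrightarrow> indicator A x *\<^sub>R c" for x
      proof (rule tendsto_eventually)
        obtain n where "norm x < real n" using reals_Archimedean2 by blast
        then show "\<forall>\<^sub>F n in sequentially. ?s n x = indicator A x *\<^sub>R c"
          by (intro eventually_sequentiallyI[of n]) (auto simp: indicator_def)
      qed
    qed (rule bounded[OF A], rule int, rule int, simp add: indicator_def)
  next
    case (add f g)
    then show ?case by (intro assms(5))
  next
    case (lim f s)
    show ?case
      by (rule assms(6)[where s = s and w = "\<lambda>x. 2 * norm (f x)"]) (use lim in \<open>auto simp: space_M\<close>)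
  qed
qed

section \<open>The shear group\<close>

definition shear_map :: "real \<Rightarrow> 'a::real_vector \<times> 'a \<Rightarrow> 'a \<times> 'a" where
  "shear_map t = (\<lambda>(x, y). (x - t *\<^sub>R y, y))"

lemma shear_map_add: "shear_map s (shear_map t z) = shear_map (s + t) z"
  by (simp add: shear_map_def case_prod_beta algebra_simps)

lemma shear_map_0 [simp]: "shear_map 0 z = z"
  by (simp add: shear_map_def case_prod_beta)

lemma continuous_on_shear_map [continuous_intros]:
  fixes g :: "'b::topological_space \<Rightarrow> 'a::real_normed_vector \<times> 'a"
  shows "continuous_on S f \<Longrightarrow> continuous_on S g \<Longrightarrow> continuous_on S (\<lambda>w. shear_map (f w) (g w))"
  unfolding shear_map_def case_prod_beta by (intro continuous_intros)

locale sheared = fibred "lborel :: 'a measure" P for P :: "'a::euclidean_space measure" +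
  assumes sets_P [measurable_cong]: "sets P = sets borel"
begin

lemma sets_N: "sets N = sets borel"
proof -
  have "sets N = sets (borel \<Otimes>\<^sub>M (borel :: 'a measure))"
    by (intro sets_pair_measure_cong sets_lborel sets_P)
  also have "borel \<Otimes>\<^sub>M borel = (borel :: ('a \<times> 'a) measure)" by (rule borel_prod)
  finally show ?thesis .
qed

lemma measurable_shear_map [measurable]: "shear_map t \<in> N \<rightarrow>\<^sub>M N"
proof -
  have "shear_map t \<in> borel \<rightarrow>\<^sub>M (borel :: ('a \<times> 'a) measure)"
    by (intro borel_measurable_continuous_onI continuous_intros)
  then show ?thesis by (simp add: measurable_cong_sets[OF sets_N sets_N])
qed

text \<open>For each fixed \<open>y\<close> the shear is a translation in \<open>x\<close>, which Lebesgue measure does not see.\<close>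

lemma distr_shear_map: "distr N N (shear_map t) = N"
proof (rule measure_eqI)
  fix A assume "A \<in> sets (distr N N (shear_map t))"
  then have A [measurable]: "A \<in> sets N" by simp
  have "emeasure (distr N N (shear_map t)) A = (\<integral>\<^sup>+z. indicator A z \<partial>distr N N (shear_map t))"
    using A by (subst nn_integral_indicator) simp_all
  also have "\<dots> = (\<integral>\<^sup>+z. indicator A (shear_map t z) \<partial>N)"
    by (rule nn_integral_distr) measurable
  also have "\<dots> = (\<integral>\<^sup>+y. \<integral>\<^sup>+x. indicator A (shear_map t (x, y)) \<partial>lborel \<partial>P)"
    by (rule nn_integral_snd[symmetric]) measurable
  also have "\<dots> = (\<integral>\<^sup>+y. \<integral>\<^sup>+x. indicator A (x, y) \<partial>lborel \<partial>P)"
  proof (rule nn_integral_cong)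
    fix y assume "y \<in> space P"
    then have [measurable]: "(\<lambda>x. indicator A (x, y) :: ennreal) \<in> borel_measurable borel"
      by measurable
    have "(\<integral>\<^sup>+x. indicator A (x, y) \<partial>(lborel :: 'a measure)) =
        (\<integral>\<^sup>+x. indicator A (x, y) \<partial>distr lborel borel ((+) (- t *\<^sub>R y)))"
      by (simp only: lborel_distr_plus)
    also have "\<dots> = (\<integral>\<^sup>+x. indicator A (- t *\<^sub>R y + x, y) \<partial>lborel)"
      by (rule nn_integral_distr) simp_all
    finally show "(\<integral>\<^sup>+x. indicator A (shear_map t (x, y)) \<partial>lborel) = (\<integral>\<^sup>+x. indicator A (x, y) \<partial>lborel)"
      by (simp add: shear_map_def)
  qed
  also have "\<dots> = (\<integral>\<^sup>+z. indicator A z \<partial>N)"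
    by (rule nn_integral_snd) measurable
  finally show "emeasure (distr N N (shear_map t)) A = emeasure N A"
    using A by (simp only: nn_integral_indicator)
qed simp

lemma shear_ae_class:
  assumes f: "f \<in> ess_bounded N"
  shows "shear N t (ae_class N f) = ae_class N (\<lambda>z. f (shear_map t z))"
proof -
  have "shear N t (ae_class N f) = ae_class N (\<lambda>(x, y). f (x - t *\<^sub>R y, y))"
    unfolding shear_def
  proof (rule on_class_ae_class[OF f])
    fix g assume "AE z in N. g z = f z"
    then have "AE z in N. g (shear_map t z) = f (shear_map t z)"
      by (intro AE_distrD[OF measurable_shear_map, unfolded distr_shear_map])
    then have "AE z in N. (\<lambda>(x, y). g (x - t *\<^sub>R y, y)) z = (\<lambda>(x, y). f (x - t *\<^sub>R y, y)) z"
      by (rule eventually_mono) (simp add: shear_map_def case_prod_beta)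
    then show "ae_class N (\<lambda>(x, y). g (x - t *\<^sub>R y, y)) = ae_class N (\<lambda>(x, y). f (x - t *\<^sub>R y, y))"
      by (rule ae_class_cong)
  qed
  also have "(\<lambda>(x, y). f (x - t *\<^sub>R y, y)) = (\<lambda>z. f (shear_map t z))"
    by (simp add: shear_map_def fun_eq_iff)
  finally show ?thesis .
qed

lemma koopman_shear: "koopman N N (shear_map t) (shear N t)"
  by unfold_locales (simp_all add: distr_shear_map shear_ae_class)

lemma ess_bounded_shear: "f \<in> ess_bounded N \<Longrightarrow> (\<lambda>z. f (shear_map t z)) \<in> ess_bounded N"
  by (rule koopman.ess_bounded_T[OF koopman_shear])

lemma shear_add:
  assumes "a \<in> Linf N" shows "shear N (s + t) a = shear N s (shear N t a)"
  using assms
  by (auto elim!: LinfE simp: shear_ae_class ess_bounded_shear shear_map_add add.commute)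

lemma shear_0:
  assumes "a \<in> Linf N" shows "shear N 0 a = a"
  using assms by (auto elim!: LinfE simp: shear_ae_class)

lemma star_automorphism_shear: "star_automorphism N (shear N t)"
proof -
  have maps: "shear N t a \<in> Linf N" if "a \<in> Linf N" for a t
    using koopman.K_Linf[OF koopman_shear that] .
  have "bij_betw (shear N t) (Linf N) (Linf N)"
  proof (rule bij_betw_byWitness[where f' = "shear N (- t)"])
    show "\<forall>a\<in>Linf N. shear N (- t) (shear N t a) = a" "\<forall>a\<in>Linf N. shear N t (shear N (- t) a) = a"
      using shear_add[of _ "- t" t] shear_add[of _ t "- t"] by (simp_all add: shear_0)
  qed (use maps in auto)
  then show ?thesis
    by (simp add: star_automorphism_def koopman.star_homomorphism[OF koopman_shear])
qed

lemma trace_preserving_shear: "trace_preserving N N (shear N t)"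
  by (rule koopman.trace_preserving[OF koopman_shear])

lemma integrable_shear:
  fixes h :: "'a \<times> 'a \<Rightarrow> 'b::{banach, second_countable_topology}"
  assumes "integrable N h" shows "integrable N (\<lambda>z. h (shear_map t z))"
  using assms by (intro integrable_distr[OF measurable_shear_map]) (simp add: distr_shear_map)

lemma integral_shear:
  fixes h :: "'a \<times> 'a \<Rightarrow> 'b::{banach, second_countable_topology}"
  assumes [measurable]: "h \<in> borel_measurable N"
  shows "(\<integral>z. h (shear_map t z) \<partial>N) = (\<integral>z. h z \<partial>N)"
  using integral_distr[OF measurable_shear_map assms, of t] by (simp add: distr_shear_map)

lemma emeasure_compact: "compact S \<Longrightarrow> emeasure N S < \<infinity>"
proof -
  assume S: "compact S"
  have c: "compact (fst ` S)" using S by (intro compact_continuous_image continuous_intros)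
  have "emeasure N S \<le> emeasure N (fst ` S \<times> space P)"
  proof (rule emeasure_mono)
    show "S \<subseteq> fst ` S \<times> space P"
      using sets_eq_imp_space_eq[OF sets_P] by force
    show "fst ` S \<times> space P \<in> sets N"
      using c by (intro pair_measureI) (auto intro: borel_compact)
  qed
  also have "\<dots> = emeasure lborel (fst ` S)"
    using c F.emeasure_pair_measure_Times[of "fst ` S" lborel "space P"]
    by (simp add: borel_compact F.emeasure_space_1)
  also have "\<dots> < \<infinity>" using c by (rule emeasure_compact_finite)
  finally show ?thesis .
qed

text \<open>Up to the sign of \<open>t\<close> this is weak continuity of the group on the predual. The functions \<open>h\<close> for which it holds are closed under dominated limits: the
  shears preserve the \<open>L\<^sup>1\<close> distance, so that the convergence is uniform in \<open>t\<close>. For continuous \<open>h\<close>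
  with bounded support it is dominated convergence, as the supports stay in a fixed compact set
  while \<open>t\<close> is bounded.\<close>

lemma continuous_shear_predual:
  fixes f h :: "'a \<times> 'a \<Rightarrow> complex"
  assumes f: "f \<in> ess_bounded N" and h: "integrable N h"
  shows "continuous_on UNIV (\<lambda>t. \<integral>z. h (shear_map t z) * f z \<partial>N)"
proof -
  from f obtain C where "C \<ge> 0" and [measurable]: "f \<in> borel_measurable N"
    and C: "AE z in N. norm (f z) \<le> C" by (rule ess_boundedE)
  have int: "integrable N (\<lambda>z. h (shear_map t z) * f z)" if "integrable N h" for h :: "_ \<Rightarrow> complex" and t
    by (intro integrable_mult_ess_bounded integrable_shear that f)
  show ?thesis
    using sets_N emeasure_compact h
  proof (rule integrable_induct_continuous)
    fix g :: "'a \<times> 'a \<Rightarrow> complex"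
    assume g: "continuous_on UNIV g" and "bounded {z. g z \<noteq> 0}"
    then obtain R where R: "\<And>z. g z \<noteq> 0 \<Longrightarrow> norm z \<le> R" by (auto simp: bounded_iff)
    have [measurable]: "g \<in> borel_measurable N"
      using borel_measurable_continuous_onI[OF g] by (simp add: measurable_cong_sets[OF sets_N])
    have "compact (g ` cball 0 R)"
      by (intro compact_continuous_image continuous_on_subset[OF g]) auto
    then have "bounded (g ` cball 0 R)" by (rule compact_imp_bounded)
    then obtain D where D: "\<And>z. z \<in> cball 0 R \<Longrightarrow> norm (g z) \<le> D"
      unfolding bounded_iff by blast
    have D': "norm (g z) \<le> max D 0" for z
      using D[of z] R[of z] by (cases "g z = 0") (auto simp: le_max_iff_disj)
    show "continuous_on UNIV (\<lambda>t. \<integral>z. g (shear_map t z) * f z \<partial>N)"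
    proof (rule continuous_on_sequentiallyI)
      fix u :: "nat \<Rightarrow> real" and t assume u: "u \<longlonglongrightarrow> t"
      then obtain B where B: "\<And>n. \<bar>u n\<bar> \<le> B"
        using Bseq_def[of u] convergent_imp_Bseq[of u] by (auto simp: convergent_def)
      \<comment> \<open>contains the supports of all \<open>g \<circ> shear_map (u n)\<close>, as \<open>\<bar>x\<bar> \<le> \<bar>x - u n y\<bar> + \<bar>u n\<bar> \<bar>y\<bar>\<close>\<close>
      let ?S = "cball 0 (R + B * R) \<times> cball 0 R :: ('a \<times> 'a) set"
      let ?w = "\<lambda>z. max D 0 * C * indicator ?S z"
      have supp: "z \<in> ?S" if "g (shear_map (u n) z) \<noteq> 0" for n z
      proof -
        obtain x y where z: "z = (x, y)" by (cases z)
        have "norm (x - u n *\<^sub>R y, y) \<le> R" using R[OF that] by (simp add: z shear_map_def)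
        then have x: "norm (x - u n *\<^sub>R y) \<le> R" and y: "norm y \<le> R"
          using norm_fst_le[of "x - u n *\<^sub>R y" y] norm_snd_le[of y "x - u n *\<^sub>R y"] by auto
        have "norm (u n *\<^sub>R y) \<le> B * R"
          unfolding norm_scaleR using B[of n] y by (intro mult_mono) auto
        with x norm_triangle_sub[of x "u n *\<^sub>R y"] y show ?thesis by (simp add: z)
      qed
      show "(\<lambda>n. \<integral>z. g (shear_map (u n) z) * f z \<partial>N) \<longlonglongrightarrow> (\<integral>z. g (shear_map t z) * f z \<partial>N)"
      proof (rule integral_dominated_convergence[where w = ?w])
        have "compact ?S" by (intro compact_Times compact_cball)
        then show "integrable N ?w"
          using emeasure_compact[of ?S]
          by (intro integrable_mult_right integrable_real_indicator) (auto simp: sets_N borel_compact)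
        show "AE z in N. (\<lambda>n. g (shear_map (u n) z) * f z) \<longlonglongrightarrow> g (shear_map t z) * f z"
        proof (intro AE_I2 tendsto_mult tendsto_const)
          fix z
          have "continuous_on UNIV (\<lambda>t. g (shear_map t z))"
            by (intro continuous_on_compose2[OF g] continuous_intros) auto
          then have "isCont (\<lambda>t. g (shear_map t z)) t" by (simp add: continuous_on_eq_continuous_at)
          then show "(\<lambda>n. g (shear_map (u n) z)) \<longlonglongrightarrow> g (shear_map t z)"
            using u by (rule isCont_tendsto_compose)
        qed
        show "AE z in N. norm (g (shear_map (u n) z) * f z) \<le> ?w z" for n
          using C
        proof eventually_elim
          case (elim z)
          show ?case
          proof (cases "g (shear_map (u n) z) = 0")
            case True
            then show ?thesis using \<open>C \<ge> 0\<close> by simp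
          next
            case False
            from supp[OF this] have w: "?w z = max D 0 * C" by simp
            show ?thesis
              unfolding w norm_mult by (rule mult_mono[OF D' elim]) auto
          qed
        qed
      qed measurable
    qed
  next
    fix g h :: "'a \<times> 'a \<Rightarrow> complex"
    assume g: "integrable N g" "continuous_on UNIV (\<lambda>t. \<integral>z. g (shear_map t z) * f z \<partial>N)"
      and h: "integrable N h" "continuous_on UNIV (\<lambda>t. \<integral>z. h (shear_map t z) * f z \<partial>N)"
    have "(\<integral>z. (g (shear_map t z) + h (shear_map t z)) * f z \<partial>N) =
        (\<integral>z. g (shear_map t z) * f z \<partial>N) + (\<integral>z. h (shear_map t z) * f z \<partial>N)" for t
      using int[OF g(1)] int[OF h(1)] by (simp add: distrib_right)
    with g h show "continuous_on UNIV (\<lambda>t. \<integral>z. (g (shear_map t z) + h (shear_map t z)) * f z \<partial>N)"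
      by (simp add: continuous_on_add)
  next
    fix s and w :: "'a \<times> 'a \<Rightarrow> real" and h :: "'a \<times> 'a \<Rightarrow> complex"
    assume s: "\<And>i. integrable N (s i)"
      and cont: "\<And>i. continuous_on UNIV (\<lambda>t. \<integral>z. s i (shear_map t z) * f z \<partial>N)"
      and h: "integrable N h" and w: "integrable N w"
      and lim: "\<And>z. (\<lambda>i. s i z) \<longlonglongrightarrow> h z" and bound: "\<And>i z. norm (s i z) \<le> w z"
    note [measurable] = borel_measurable_integrable[OF h] borel_measurable_integrable[OF s]
    have "(\<lambda>i. \<integral>z. norm (s i z - h z) \<partial>N) \<longlonglongrightarrow> (\<integral>z. 0 \<partial>N)"
    proof (rule integral_dominated_convergence[where w = "\<lambda>z. w z + norm (h z)"])
      show "integrable N (\<lambda>z. w z + norm (h z))" using w h by simp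
      show "AE z in N. (\<lambda>i. norm (s i z - h z)) \<longlonglongrightarrow> 0"
      proof (rule AE_I2)
        fix z
        have "(\<lambda>i. s i z - h z) \<longlonglongrightarrow> 0" using lim[of z] by (simp add: LIM_zero_iff)
        then show "(\<lambda>i. norm (s i z - h z)) \<longlonglongrightarrow> 0" by (rule tendsto_norm_zero)
      qed
      show "AE z in N. norm (norm (s i z - h z)) \<le> w z + norm (h z)" for i
      proof (rule AE_I2)
        fix z
        show "norm (norm (s i z - h z)) \<le> w z + norm (h z)"
          using bound[of i z] norm_triangle_ineq4[of "s i z" "h z"] by simp
      qed
    qed measurable
    then have L1: "(\<lambda>i. C * (\<integral>z. norm (s i z - h z) \<partial>N)) \<longlonglongrightarrow> 0"
      using tendsto_mult_right_zero by fastforce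
    have dist: "dist (\<integral>z. s i (shear_map t z) * f z \<partial>N) (\<integral>z. h (shear_map t z) * f z \<partial>N)
        \<le> C * (\<integral>z. norm (s i z - h z) \<partial>N)" for i t
    proof -
      have diff: "integrable N (\<lambda>z. s i z - h z)" using s h by simp
      have "(\<integral>z. s i (shear_map t z) * f z \<partial>N) - (\<integral>z. h (shear_map t z) * f z \<partial>N) =
          (\<integral>z. (s i (shear_map t z) - h (shear_map t z)) * f z \<partial>N)"
        using int[OF s] int[OF h] by (simp add: left_diff_distrib)
      also have "norm \<dots> \<le> (\<integral>z. norm ((s i (shear_map t z) - h (shear_map t z)) * f z) \<partial>N)"
        by (rule integral_norm_bound)
      also have "\<dots> \<le> (\<integral>z. C * norm (s i (shear_map t z) - h (shear_map t z)) \<partial>N)"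
      proof (rule integral_mono_AE)
        show "integrable N (\<lambda>z. norm ((s i (shear_map t z) - h (shear_map t z)) * f z))"
          using int[OF diff, of t] by (rule integrable_norm)
        show "integrable N (\<lambda>z. C * norm (s i (shear_map t z) - h (shear_map t z)))"
          using integrable_shear[OF diff, of t] by (intro integrable_mult_right integrable_norm)
        show "AE z in N. norm ((s i (shear_map t z) - h (shear_map t z)) * f z)
            \<le> C * norm (s i (shear_map t z) - h (shear_map t z))"
          using C by eventually_elim (simp add: norm_mult mult.commute mult_right_mono)
      qed
      also have "\<dots> = C * (\<integral>z. norm (s i z - h z) \<partial>N)"
        by (simp add: integral_shear[where h = "\<lambda>z. norm (s i z - h z)"])
      finally show ?thesis by (simp add: dist_norm)
    qed
    have "uniform_limit UNIV (\<lambda>i t. \<integral>z. s i (shear_map t z) * f z \<partial>N)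
        (\<lambda>t. \<integral>z. h (shear_map t z) * f z \<partial>N) sequentially"
    proof (rule uniform_limitI)
      fix e :: real assume "e > 0"
      with L1 have "\<forall>\<^sub>F i in sequentially. C * (\<integral>z. norm (s i z - h z) \<partial>N) < e"
        by (rule order_tendstoD)
      then show "\<forall>\<^sub>F i in sequentially. \<forall>t\<in>UNIV.
          dist (\<integral>z. s i (shear_map t z) * f z \<partial>N) (\<integral>z. h (shear_map t z) * f z \<partial>N) < e"
        by (rule eventually_mono) (use dist in \<open>auto intro: le_less_trans\<close>)
    qed
    with cont show "continuous_on UNIV (\<lambda>t. \<integral>z. h (shear_map t z) * f z \<partial>N)"
      by (intro uniform_limit_theorem[where F = sequentially and A = UNIV]) auto
  qed
qed

lemma weak_star_continuous_group_shear: "weak_star_continuous_group N (shear N)"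
  unfolding weak_star_continuous_group_def
proof (intro conjI allI ballI impI)
  fix a and h :: "'a \<times> 'a \<Rightarrow> complex" assume "a \<in> Linf N" and h: "integrable N h"
  then obtain f where f: "f \<in> ess_bounded N" "a = ae_class N f" by (auto elim: LinfE)
  note [measurable] = borel_measurable_integrable[OF h] ess_bounded_measurable[OF f(1)]
  have "linf_pairing N h (shear N t a) = (\<integral>z. h (shear_map (- t) z) * f z \<partial>N)" for t
  proof -
    have "linf_pairing N h (shear N t a) = (\<integral>z. h z * f (shear_map t z) \<partial>N)"
      using f h by (simp add: shear_ae_class linf_pairing_ae_class ess_bounded_shear)
    also have "\<dots> = (\<integral>z. h (shear_map (- t) (shear_map t z)) * f (shear_map t z) \<partial>N)"
      by (simp add: shear_map_add)
    also have "\<dots> = (\<integral>z. h (shear_map (- t) z) * f z \<partial>N)"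
      by (rule integral_shear[where h = "\<lambda>z. h (shear_map (- t) z) * f z"]) measurable
    finally show ?thesis .
  qed
  then show "continuous_on UNIV (\<lambda>t. linf_pairing N h (shear N t a))"
    using continuous_on_compose2[OF continuous_shear_predual[OF f(1) h], of UNIV uminus]
    by (simp add: continuous_on_minus)
qed (simp_all add: shear_0 shear_add)

end

section \<open>The dilation of the Poisson semigroup\<close>

context fibred
begin

lemma AE_pairI:
  assumes "{z \<in> space N. Q z} \<in> sets N" and "AE x in M. R x" and "AE y in P. S y"
    and "\<And>x y. R x \<Longrightarrow> S y \<Longrightarrow> Q (x, y)"
  shows "AE z in N. Q z"
proof (rule AE_pair_measure)
  show "AE x in M. AE y in P. Q (x, y)"
    using assms(2)
  proof eventually_elim
    case (elim x)
    with assms(3,4) show ?case by (auto elim: eventually_mono)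
  qed
qed fact

lemma ess_bounded_tensor:
  assumes f: "f \<in> ess_bounded M" and g: "g \<in> ess_bounded P"
  shows "(\<lambda>z. f (fst z) * g (snd z)) \<in> ess_bounded N"
proof -
  from f obtain C where "C \<ge> 0" and [measurable]: "f \<in> borel_measurable M"
    and C: "AE x in M. norm (f x) \<le> C" by (rule ess_boundedE)
  from g obtain D where "D \<ge> 0" and [measurable]: "g \<in> borel_measurable P"
    and D: "AE y in P. norm (g y) \<le> D" by (rule ess_boundedE)
  show ?thesis
  proof (rule ess_boundedI)
    show "AE z in N. norm (f (fst z) * g (snd z)) \<le> C * D"
      by (rule AE_pairI[OF _ C D]) (use \<open>C \<ge> 0\<close> in \<open>auto simp: norm_mult intro: mult_mono\<close>)
  qed measurable
qed

lemma linf_tensor_ae_class: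
  assumes f: "f \<in> ess_bounded M" and g: "g \<in> ess_bounded P"
  shows "linf_tensor M P (ae_class M f) (ae_class P g) = ae_class N (\<lambda>z. f (fst z) * g (snd z))"
proof -
  have "linf_tensor M P (ae_class M f) (ae_class P g) = ae_class N (\<lambda>(x, y). f x * g y)"
    unfolding linf_tensor_def
  proof (rule on_class2_ae_class[OF f g])
    fix f' g' assume f': "f' \<in> ess_bounded M" "AE x in M. f' x = f x"
      and g': "g' \<in> ess_bounded P" "AE y in P. g' y = g y"
    note [measurable] = ess_bounded_measurable[OF f] ess_bounded_measurable[OF g]
      ess_bounded_measurable[OF f'(1)] ess_bounded_measurable[OF g'(1)]
    have "AE z in N. (case z of (x, y) \<Rightarrow> f' x * g' y) = (case z of (x, y) \<Rightarrow> f x * g y)"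
      by (rule AE_pairI[OF _ f'(2) g'(2)]) auto
    then show "ae_class N (\<lambda>(x, y). f' x * g' y) = ae_class N (\<lambda>(x, y). f x * g y)"
      by (rule ae_class_cong)
  qed
  then show ?thesis by (simp add: case_prod_unfold)
qed

lemma koopman_tensor_one: "koopman M N fst (\<lambda>a. linf_tensor M P a (linf_one P))"
  by unfold_locales (simp_all add: distr_fst linf_one_def linf_tensor_ae_class)

lemma fibre_mean_tensor:
  assumes "a \<in> Linf M" "b \<in> Linf P"
  shows "fibre_mean M P (linf_tensor M P a b) = linf_scale M (linf_integral P b) a"
proof -
  from assms obtain f g where f: "f \<in> ess_bounded M" "a = ae_class M f"
    and g: "g \<in> ess_bounded P" "b = ae_class P g" by (metis LinfE)
  then show ?thesis
    by (simp add: linf_tensor_ae_class fibre_mean_ae_class ess_bounded_tensor linf_scale_ae_class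
        linf_integral_ae_class mult.commute)
qed

end

text \<open>Both sides average the translates \<open>f (x - t z)\<close> over \<open>z\<close>. The identity is proved for every
  representative \<open>f\<close> of the class; as the right-hand side depends on the class only, this also
  shows that the convolution does not depend on the representative.\<close>

lemma poisson_semigroup_dilation:
  fixes a :: "(real ^ 'n) linf"
  defines "P \<equiv> density lborel (\<lambda>y :: real ^ 'n. ennreal (poisson_kernel 1 y))"
  assumes t: "t \<ge> 0" and a: "a \<in> Linf lborel"
  shows "poisson_semigroup t a =
    fibre_mean lborel P (shear (lborel \<Otimes>\<^sub>M P) t (linf_tensor lborel P a (linf_one P)))"
proof -
  interpret F: prob_space P unfolding P_def by (rule prob_space_poisson)
  interpret S: sheared P by unfold_locales (simp add: P_def)
  interpret K: fibred_koopman "lborel :: (real ^ 'n) measure" P "\<lambda>a. linf_tensor lborel P a (linf_one P)"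
    by (rule fibred_koopman.intro[OF S.fibred_axioms S.koopman_tensor_one])
  show ?thesis
  proof (cases "t = 0")
    case True
    with a show ?thesis by (simp add: poisson_semigroup_def S.shear_0 K.K_Linf K.fibre_mean_K)
  next
    case False
    with t have "t > 0" by simp
    define conv where
      "conv f = ae_class lborel (\<lambda>x. \<integral>y. complex_of_real (poisson_kernel t y) * f (x - y) \<partial>lborel)"
      for f :: "real ^ 'n \<Rightarrow> complex"
    have conv: "conv f =
        fibre_mean lborel P (shear S.N t (linf_tensor lborel P (ae_class lborel f) (linf_one P)))"
      if f: "f \<in> ess_bounded lborel" for f
    proof -
      have [measurable]: "f \<in> borel_measurable borel" using ess_bounded_measurable[OF f] by simp
      have "fibre_mean lborel P (shear S.N t (linf_tensor lborel P (ae_class lborel f) (linf_one P))) =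
          ae_class lborel (\<lambda>x. \<integral>z. f (fst (shear_map t (x, z))) \<partial>P)"
        using f by (simp add: K.K S.shear_ae_class K.ess_bounded_T
            S.fibre_mean_ae_class[OF S.ess_bounded_shear[OF K.ess_bounded_T]])
      also have "(\<lambda>x. \<integral>z. f (fst (shear_map t (x, z))) \<partial>P) =
          (\<lambda>x. \<integral>y. complex_of_real (poisson_kernel t y) * f (x - y) \<partial>lborel)"
        by (rule ext, subst integral_poisson_kernel_dilation[OF \<open>t > 0\<close>])
          (simp_all add: P_def shear_map_def)
      finally show ?thesis by (simp add: conv_def)
    qed
    from a obtain f where f: "f \<in> ess_bounded lborel" "a = ae_class lborel f" by (rule LinfE)
    have "poisson_semigroup t a = on_class conv a"
      using False by (simp add: poisson_semigroup_def conv_def[abs_def])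
    also have "\<dots> = conv f"
      unfolding f(2)
    proof (rule on_class_ae_class[OF f(1)])
      fix g assume "g \<in> ess_bounded lborel" "AE x in lborel. g x = f x"
      then show "conv g = conv f" by (simp add: conv f(1) ae_class_cong)
    qed
    finally show ?thesis by (simp add: conv[OF f(1)] f(2))
  qed
qed

theorem mainTheorem7:
  fixes \<mu> \<nu> :: "(real ^ 'n) measure"
    and N :: "((real ^ 'n) \<times> (real ^ 'n)) measure"
    and \<omega> :: real
    and J :: "(real ^ 'n) linf \<Rightarrow> ((real ^ 'n) \<times> (real ^ 'n)) linf"
    and U :: "real \<Rightarrow> ((real ^ 'n) \<times> (real ^ 'n)) linf \<Rightarrow> ((real ^ 'n) \<times> (real ^ 'n)) linf"
  assumes mu: "\<mu> = lborel"
    and omega: "\<omega> = sphere_area (CARD('n) + 1)"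
    and nu: "\<nu> = density \<mu>
      (\<lambda>y. ennreal (2 / (\<omega> * (1 + (norm y)\<^sup>2) powr (real (CARD('n) + 1) / 2))))"
    and N: "N = \<mu> \<Otimes>\<^sub>M \<nu>"
    and J: "J = (\<lambda>f. linf_tensor \<mu> \<nu> f (linf_one \<nu>))"
    and U: "U = shear N"
  shows "prob_space \<nu>
    \<and> (star_monomorphism \<mu> N J \<and> unital_map \<mu> N J \<and> normal_map \<mu> N J \<and> trace_preserving \<mu> N J)
    \<and> (\<exists>!E. E \<in> extensional (Linf N) \<and> tp_normal_faithful_cond_exp \<mu> N J E)
    \<and> weak_star_continuous_group N U
    \<and> (\<forall>t. star_automorphism N (U t) \<and> trace_preserving N N (U t))
    \<and> (\<forall>E. tp_normal_faithful_cond_exp \<mu> N J E \<longrightarrow>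
          (\<forall>f\<in>Linf \<mu>. \<forall>g\<in>Linf \<nu>.
             E (linf_tensor \<mu> \<nu> f g) = linf_scale \<mu> (linf_integral \<nu> g) f)
        \<and> (\<forall>t\<ge>0. \<forall>f\<in>Linf \<mu>. poisson_semigroup t f = E (U t (J f))))"
proof -
  define P where "P = density lborel (\<lambda>y :: real ^ 'n. ennreal (poisson_kernel 1 y))"
  have nu_eq: "\<nu> = P"
    unfolding nu mu omega P_def poisson_kernel_def by simp
  interpret F: prob_space P unfolding P_def by (rule prob_space_poisson)
  interpret S: sheared P by unfold_locales (simp add: P_def)
  have J_eq: "J = (\<lambda>a. linf_tensor lborel P a (linf_one P))" by (simp add: J mu nu_eq)
  have N_eq: "N = lborel \<Otimes>\<^sub>M P" by (simp add: N mu nu_eq)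
  interpret K: fibred_koopman lborel P J
    unfolding J_eq by (rule fibred_koopman.intro[OF S.fibred_axioms S.koopman_tensor_one])
  let ?E = "fibre_mean lborel P"
  have E: "tp_normal_faithful_cond_exp \<mu> N J ?E"
    unfolding mu N_eq by (rule K.fibre_mean_cond_exp)
  have unique: "E x = ?E x" if "tp_normal_faithful_cond_exp \<mu> N J E" "x \<in> Linf N" for E x
    by (rule K.conditional_expectation_unique[OF lborel.sigma_finite_measure_axioms])
      (use that E in \<open>simp_all add: mu N_eq\<close>)
  have prob: "prob_space \<nu>" unfolding nu_eq by (rule F.prob_space_axioms)
  have J_props: "star_monomorphism \<mu> N J" "unital_map \<mu> N J" "normal_map \<mu> N J"
    "trace_preserving \<mu> N J"
    unfolding mu N_eq by (rule K.star_monomorphism K.unital K.K_normal K.trace_preserving)+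
  have U_props: "weak_star_continuous_group N U" "star_automorphism N (U t)"
    "trace_preserving N N (U t)" for t
    unfolding U N_eq
    by (rule S.weak_star_continuous_group_shear S.star_automorphism_shear S.trace_preserving_shear)+
  have ex1: "\<exists>!E. E \<in> extensional (Linf N) \<and> tp_normal_faithful_cond_exp \<mu> N J E"
  proof (rule ex_ex1I)
    have "tp_normal_faithful_cond_exp \<mu> N J (restrict ?E (Linf N))"
      using E by (rule tp_normal_faithful_cond_exp_cong) (simp_all add: mu N_eq K.K_Linf)
    then show "\<exists>E. E \<in> extensional (Linf N) \<and> tp_normal_faithful_cond_exp \<mu> N J E"
      by (intro exI[of _ "restrict ?E (Linf N)"]) simp
    show "E = E'" if "E \<in> extensional (Linf N) \<and> tp_normal_faithful_cond_exp \<mu> N J E"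
      "E' \<in> extensional (Linf N) \<and> tp_normal_faithful_cond_exp \<mu> N J E'" for E E'
    proof (rule extensionalityI[of E "Linf N" E'])
      show "E x = E' x" if "x \<in> Linf N" for x
        using unique[of E x] unique[of E' x] that
          \<open>E \<in> extensional (Linf N) \<and> tp_normal_faithful_cond_exp \<mu> N J E\<close>
          \<open>E' \<in> extensional (Linf N) \<and> tp_normal_faithful_cond_exp \<mu> N J E'\<close> by simp
    qed (use that in simp_all)
  qed
  have tensor: "E (linf_tensor \<mu> \<nu> f g) = linf_scale \<mu> (linf_integral \<nu> g) f"
    if "tp_normal_faithful_cond_exp \<mu> N J E" "f \<in> Linf \<mu>" "g \<in> Linf \<nu>" for E f g
  proof -
    have "linf_tensor \<mu> \<nu> f g \<in> Linf N"
      using that(2,3) by (auto elim!: LinfE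
          simp: mu nu_eq N_eq S.linf_tensor_ae_class S.ess_bounded_tensor intro!: ae_class_in_Linf)
    with that show ?thesis
      by (simp add: unique) (simp add: mu nu_eq S.fibre_mean_tensor)
  qed
  have poisson: "poisson_semigroup t f = E (U t (J f))"
    if "tp_normal_faithful_cond_exp \<mu> N J E" "t \<ge> 0" "f \<in> Linf \<mu>" for E t f
  proof -
    have "J f \<in> Linf N" using that(3) K.K_Linf by (simp add: mu N_eq)
    then have "U t (J f) \<in> Linf N"
      using U_props(2)[of t] unfolding star_automorphism_def by (blast dest: bij_betw_apply)
    with that show ?thesis
      by (simp add: unique)
        (simp add: U J_eq N_eq mu P_def poisson_semigroup_dilation)
  qed
  show ?thesis
    by (intro conjI allI impI ballI;
        (rule prob J_props U_props ex1 | erule (2) tensor | erule (2) poisson))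
qed

end
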